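(* Let $q\geq 2$ and $m\geq 2$ be integers, let $\alpha=[0;\overline{1,m}]$, and let $m_1,m_2\geq 2$ be integers with $\gcd(q-1,m_1)=\gcd(m,m_2)=1$. Then there exists $\delta>0$ such that for all integers $a_1,a_2$, $$\big|\{0\leq n<N:\ S_q(n)\equiv a_1 \pmod{m_1},\ S_\alpha(n)\equiv a_2\pmod{m_2}\}\big|=\frac{N}{m_1m_2}+O(N^{1-\delta})$$ for positive integers $N$, with implied constant independent of $N$.
   Context: $S_q(n)$ denotes the sum of the digits of the non-negative integer $n$ in base $q$. The number $\alpha=[0;\overline{1,m}]=\frac{-m+\sqrt{m^2+4m}}{2}$ has simple continued fraction $[0;c_1,c_2,\ldots]$ with partial quotients $c_i=1$ for $i$ odd and $c_i=m$ for $i$ even ($i\ge 1$). The denominators $(q_i)_{i\geq 0}$ of its convergents satisfy $q_0=q_1=1$ and, for $i\ge 2$, $q_i=mq_{i-1}+q_{i-2}$ if $i$ is even, $q_i=q_{i-1}+q_{i-2}$ if $i$ is odd. By Ostrowski's theorem every integer $n\geq 0$ can be written uniquely as $n=\sum_{i\geq 0}b_i(n)q_i$ (finitely many nonzero terms) with integers $b_i(n)$ satisfying: $0\leq b_0(n)<c_1$; $0\leq b_i(n)\leq c_{i+1}$ for $i\geq 1$; and for $i\geq 1$, if $b_i(n)=c_{i+1}$ then $b_{i-1}(n)=0$. This is the Ostrowski $\alpha$-representation of $n$, and $S_\alpha(n)=\sum_{i\geq 0}b_i(n)$. *)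

theory Defs
  imports Complex_Main "HOL-Number_Theory.Cong"
begin

definition digit_sum :: "nat \<Rightarrow> nat \<Rightarrow> nat" where
  "digit_sum q n = (\<Sum>i | q ^ i \<le> n. n div q ^ i mod q)"

text \<open>
  The simple continued fraction of an irrational real number, by iterating the Gauss map.
  For rational numbers the values past the end of the expansion are meaningless.
\<close>

fun cf_rem :: "real \<Rightarrow> nat \<Rightarrow> real" where
  "cf_rem \<alpha> 0 = frac \<alpha>"
| "cf_rem \<alpha> (Suc i) = frac (1 / cf_rem \<alpha> i)"

fun cf_quot :: "real \<Rightarrow> nat \<Rightarrow> int" where
  "cf_quot \<alpha> 0 = \<lfloor>\<alpha>\<rfloor>"
| "cf_quot \<alpha> (Suc i) = \<lfloor>1 / cf_rem \<alpha> i\<rfloor>"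

fun cf_denom :: "real \<Rightarrow> nat \<Rightarrow> int" where
  "cf_denom \<alpha> 0 = 1"
| "cf_denom \<alpha> (Suc 0) = cf_quot \<alpha> 1"
| "cf_denom \<alpha> (Suc (Suc i)) =
     cf_quot \<alpha> (Suc (Suc i)) * cf_denom \<alpha> (Suc i) + cf_denom \<alpha> i"

definition ostrowski_rep :: "real \<Rightarrow> nat \<Rightarrow> (nat \<Rightarrow> int) \<Rightarrow> bool" where
  "ostrowski_rep \<alpha> n b \<longleftrightarrow>
     finite {i. b i \<noteq> 0} \<and>
     int n = (\<Sum>i | b i \<noteq> 0. b i * cf_denom \<alpha> i) \<and>
     0 \<le> b 0 \<and> b 0 < cf_quot \<alpha> 1 \<and>
     (\<forall>i\<ge>1. 0 \<le> b i \<and> b i \<le> cf_quot \<alpha> (i + 1)) \<and>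
     (\<forall>i\<ge>1. b i = cf_quot \<alpha> (i + 1) \<longrightarrow> b (i - 1) = 0)"

definition ostrowski_digit :: "real \<Rightarrow> nat \<Rightarrow> nat \<Rightarrow> int" where
  "ostrowski_digit \<alpha> n = (THE b. ostrowski_rep \<alpha> n b)"

definition ostrowski_sum :: "real \<Rightarrow> nat \<Rightarrow> int" where
  "ostrowski_sum \<alpha> n = (\<Sum>i | ostrowski_digit \<alpha> n i \<noteq> 0. ostrowski_digit \<alpha> n i)"


text \<open>
  Ostrowski's theorem, which makes the definite description above well-defined whenever
  all partial quotients after the integer part are positive.
\<close>

context
  fixes \<alpha> :: real
  assumes pos: "\<And>i. cf_quot \<alpha> (Suc i) \<ge> 1"
begin

lemma cf_denom_pos: "cf_denom \<alpha> i > 0"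
proof (induction i rule: less_induct)
  case (less i)
  consider "i = 0" | "i = 1" | j where "i = Suc (Suc j)"
    by (metis One_nat_def not0_implies_Suc)
  then show ?case
  proof cases
    case 2
    then show ?thesis using pos[of 0] by simp
  next
    case (3 j)
    have "0 < cf_denom \<alpha> j" "0 < cf_denom \<alpha> (Suc j)" "0 < cf_quot \<alpha> (Suc (Suc j))"
      using less 3 pos[of "Suc j"] by auto
    then show ?thesis using 3 by (auto simp del: cf_quot.simps intro!: add_pos_pos)
  qed auto
qed

definition adm :: "(nat \<Rightarrow> int) \<Rightarrow> bool" where
  "adm b \<longleftrightarrow> 0 \<le> b 0 \<and> b 0 < cf_quot \<alpha> 1 \<and>
     (\<forall>i\<ge>1. 0 \<le> b i \<and> b i \<le> cf_quot \<alpha> (i + 1)) \<and>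
     (\<forall>i\<ge>1. b i = cf_quot \<alpha> (i + 1) \<longrightarrow> b (i - 1) = 0)"

lemma adm_nonneg: "adm b \<Longrightarrow> 0 \<le> b i"
  unfolding adm_def by (cases i) auto

lemma adm_sum_less:
  assumes "adm b"
  shows "(\<Sum>i<k. b i * cf_denom \<alpha> i) < cf_denom \<alpha> k"
proof (induction k rule: less_induct)
  case (less k)
  consider "k = 0" | "k = 1" | j where "k = Suc (Suc j)"
    by (metis One_nat_def not0_implies_Suc)
  then show ?case
  proof cases
    case 2
    then show ?thesis using assms by (simp add: adm_def del: cf_quot.simps)
  next
    case (3 j)
    let ?c = "cf_quot \<alpha> (Suc (Suc j))"
    have bd: "b (Suc j) \<le> ?c" and z: "b (Suc j) = ?c \<Longrightarrow> b j = 0"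
      using assms unfolding adm_def by (auto simp del: cf_quot.simps dest: spec[of _ "Suc j"])
    show ?thesis
    proof (cases "b (Suc j) = ?c")
      case True
      with z less[of j] 3 show ?thesis by (simp del: cf_quot.simps)
    next
      case False
      with bd have "(b (Suc j) + 1) * cf_denom \<alpha> (Suc j) \<le> ?c * cf_denom \<alpha> (Suc j)"
        using cf_denom_pos[of "Suc j"] by (intro mult_right_mono) auto
      moreover have "(\<Sum>i<Suc j. b i * cf_denom \<alpha> i) < cf_denom \<alpha> (Suc j)"
        using less 3 by blast
      ultimately show ?thesis
        using 3 cf_denom_pos[of j] by (simp add: algebra_simps del: cf_quot.simps)
    qed
  qed auto
qed

lemma adm_unique:
  assumes "adm b" "adm b'"
    and "(\<Sum>i<k. b i * cf_denom \<alpha> i) = (\<Sum>i<k. b' i * cf_denom \<alpha> i)"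
  shows "\<forall>i<k. b i = b' i"
  using assms(3)
proof (induction k)
  case (Suc k)
  have digit: "(\<Sum>i<Suc k. d i * cf_denom \<alpha> i) div cf_denom \<alpha> k = d k" if "adm d" for d
  proof -
    have "0 \<le> (\<Sum>i<k. d i * cf_denom \<alpha> i)"
      using adm_nonneg[OF that] cf_denom_pos by (intro sum_nonneg mult_nonneg_nonneg) (auto intro: less_imp_le)
    then show ?thesis
      using adm_sum_less[OF that, of k] cf_denom_pos[of k] by simp
  qed
  have "b k = b' k"
    using digit[OF assms(1)] digit[OF assms(2)] Suc.prems by metis
  with Suc show ?case by (auto simp: less_Suc_eq)
qed auto

lemma adm_exists:
  assumes "0 \<le> x" "x < cf_denom \<alpha> k"
  shows "\<exists>b. adm b \<and> (\<forall>i\<ge>k. b i = 0) \<and> x = (\<Sum>i<k. b i * cf_denom \<alpha> i)"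
  using assms
proof (induction k arbitrary: x rule: less_induct)
  case (less k)
  have pos': "0 < cf_quot \<alpha> (Suc i)" "cf_quot \<alpha> (Suc i) \<noteq> 0" for i
    using pos[of i] by linarith+
  consider "k = 0" | "k = 1" | j where "k = Suc (Suc j)"
    by (metis One_nat_def not0_implies_Suc)
  then show ?case
  proof cases
    case 1
    with less.prems show ?thesis using pos' pos'(2)[symmetric]
      by (intro exI[of _ "\<lambda>_. 0"]) (auto simp: adm_def less_imp_le simp del: cf_quot.simps)
  next
    case 2
    with less.prems show ?thesis using pos' pos'(2)[symmetric]
      by (intro exI[of _ "\<lambda>i. if i = 0 then x else 0"])
         (auto simp: adm_def less_imp_le simp del: cf_quot.simps)
  next
    case (3 j)
    let ?c = "cf_quot \<alpha> (Suc (Suc j))" and ?Q = "cf_denom \<alpha> (Suc j)"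
    define d where "d = x div ?Q"
    define r where "r = x mod ?Q"
    have Q: "0 < ?Q" by (rule cf_denom_pos)
    have x: "x = d * ?Q + r" "0 \<le> r" "r < ?Q" "0 \<le> d"
      using Q less.prems div_mult_mod_eq[of x ?Q, symmetric] by (simp_all add: d_def r_def pos_imp_zdiv_nonneg_iff del: cf_denom.simps)
    have xlt: "x < ?c * ?Q + cf_denom \<alpha> j" using less.prems 3 by simp
    have mono: "cf_denom \<alpha> j \<le> ?Q"
    proof (cases j)
      case 0
      then show ?thesis using pos[of 0] by simp
    next
      case (Suc l)
      have "1 * cf_denom \<alpha> j \<le> cf_quot \<alpha> (Suc j) * cf_denom \<alpha> j"
        using pos[of j] cf_denom_pos[of j] by (intro mult_right_mono) auto
      then show ?thesis using Suc cf_denom_pos[of l] by (simp del: cf_quot.simps)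
    qed
    have "d \<le> ?c"
    proof (rule ccontr)
      assume "\<not> d \<le> ?c"
      then have "(?c + 1) * ?Q \<le> d * ?Q" using Q by (intro mult_right_mono) auto
      then show False using xlt x mono by (simp add: algebra_simps del: cf_quot.simps)
    qed
    obtain b where b: "adm b" "\<forall>i\<ge>Suc j. b i = 0" "d = ?c \<Longrightarrow> b j = 0"
      "r = (\<Sum>i<Suc j. b i * cf_denom \<alpha> i)"
    proof (cases "d = ?c")
      case True
      then have "r < cf_denom \<alpha> j" using xlt x by simp
      then obtain b where "adm b" "\<forall>i\<ge>j. b i = 0" "r = (\<Sum>i<j. b i * cf_denom \<alpha> i)"
        using less.IH[of j r] 3 x by auto
      then show ?thesis by (intro that[of b]) auto
    next
      case False
      then show ?thesis using less.IH[of "Suc j" r] 3 x that by auto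
    qed
    define b' where "b' = b(Suc j := d)"
    have "adm b'"
      unfolding adm_def
    proof (intro conjI allI impI)
      show "0 \<le> b' 0" "b' 0 < cf_quot \<alpha> 1"
        using b(1) by (auto simp: adm_def b'_def simp del: cf_quot.simps)
      fix i :: nat
      assume i: "1 \<le> i"
      show "0 \<le> b' i" "b' i \<le> cf_quot \<alpha> (i + 1)"
        using i b(1) \<open>d \<le> ?c\<close> x by (auto simp: adm_def b'_def simp del: cf_quot.simps)
      assume eq: "b' i = cf_quot \<alpha> (i + 1)"
      have "i \<le> Suc j"
      proof (rule ccontr)
        assume "\<not> i \<le> Suc j"
        then have "b' i = 0" using b(2) by (simp add: b'_def)
        then show False using eq pos'[of i] by (simp del: cf_quot.simps)
      qed
      then show "b' (i - 1) = 0"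
        using i eq b(1,3) by (cases "i = Suc j") (auto simp: adm_def b'_def simp del: cf_quot.simps)
    qed
    moreover have "\<forall>i\<ge>k. b' i = 0" using b(2) 3 by (simp add: b'_def)
    moreover have "(\<Sum>i<Suc j. b' i * cf_denom \<alpha> i) = r"
      unfolding b(4) by (intro sum.cong) (auto simp: b'_def)
    then have "x = (\<Sum>i<k. b' i * cf_denom \<alpha> i)"
      using x 3 by (simp add: b'_def)
    ultimately show ?thesis by blast
  qed
qed

lemma cf_denom_unbounded: "int k \<le> cf_denom \<alpha> (2 * k)"
proof (induction k)
  case (Suc k)
  have "1 \<le> cf_quot \<alpha> (Suc (Suc (2 * k))) * cf_denom \<alpha> (Suc (2 * k))"
    using pos[of "Suc (2 * k)"] cf_denom_pos[of "Suc (2 * k)"]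
    by (simp add: int_one_le_iff_zero_less zero_less_mult_iff del: cf_quot.simps)
  then show ?case using Suc by (simp del: cf_quot.simps)
qed auto

lemma ostrowski_sum_eq:
  assumes "\<forall>i\<ge>k. b i = (0::int)"
  shows "(\<Sum>i | b i \<noteq> 0. b i * cf_denom \<alpha> i) = (\<Sum>i<k. b i * cf_denom \<alpha> i)"
  using assms by (intro sum.mono_neutral_left) (auto simp: not_less[symmetric])

theorem ostrowski_ex1: "\<exists>!b. ostrowski_rep \<alpha> n b"
proof (rule ex_ex1I)
  have "int n < cf_denom \<alpha> (2 * Suc n)"
    using cf_denom_unbounded[of "Suc n"] by linarith
  then obtain b where b: "adm b" "\<forall>i\<ge>2 * Suc n. b i = 0"
    "int n = (\<Sum>i<2 * Suc n. b i * cf_denom \<alpha> i)"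
    using adm_exists[of "int n" "2 * Suc n"] by (metis of_nat_0_le_iff)
  have "{i. b i \<noteq> 0} \<subseteq> {..<2 * Suc n}" using b(2) by (auto simp: not_less[symmetric])
  then have "finite {i. b i \<noteq> 0}" by (rule finite_subset) auto
  then show "\<exists>b. ostrowski_rep \<alpha> n b"
    using b(1,3) ostrowski_sum_eq[OF b(2)]
    by (intro exI[of _ b]) (auto simp: ostrowski_rep_def adm_def simp del: cf_quot.simps)
next
  fix b b' :: "nat \<Rightarrow> int"
  assume "ostrowski_rep \<alpha> n b" "ostrowski_rep \<alpha> n b'"
  then have adm: "adm b" "adm b'" and fin: "finite ({i. b i \<noteq> 0} \<union> {i. b' i \<noteq> 0})"
    and eq: "(\<Sum>i | b i \<noteq> 0. b i * cf_denom \<alpha> i) = (\<Sum>i | b' i \<noteq> 0. b' i * cf_denom \<alpha> i)"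
    by (auto simp: ostrowski_rep_def adm_def simp del: cf_quot.simps)
  obtain k where "\<forall>i \<in> {i. b i \<noteq> 0} \<union> {i. b' i \<noteq> 0}. i < k"
    using fin finite_nat_set_iff_bounded by metis
  then have k: "\<forall>i\<ge>k. b i = 0" "\<forall>i\<ge>k. b' i = 0"
    by (auto simp: not_less[symmetric])
  have "\<forall>i<k. b i = b' i"
    using adm_unique[OF adm] eq ostrowski_sum_eq[OF k(1)] ostrowski_sum_eq[OF k(2)] by simp
  with k show "b = b'" by (metis ext not_less)
qed

end

text \<open>The number \<open>[0; 1, m, 1, m, \<dots>]\<close> in closed form.\<close>

lemma alpha_quadratic:
  fixes m :: nat and \<alpha> :: real
  assumes "\<alpha> = (- real m + sqrt (real m ^ 2 + 4 * real m)) / 2"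
  shows "\<alpha> * (\<alpha> + real m) = real m"
proof -
  have "2 * \<alpha> + real m = sqrt (real m ^ 2 + 4 * real m)"
    unfolding assms by (simp add: field_simps)
  then have "(2 * \<alpha> + real m) ^ 2 = real m ^ 2 + 4 * real m"
    by (simp only: real_sqrt_pow2 add_nonneg_nonneg zero_le_power of_nat_0_le_iff
        mult_nonneg_nonneg zero_le_numeral)
  then show ?thesis by (simp add: power2_eq_square algebra_simps)
qed

lemma cf_rem_periodic:
  fixes m :: nat and \<alpha> :: real
  assumes "m \<ge> 1" and "\<alpha> = (- real m + sqrt (real m ^ 2 + 4 * real m)) / 2"
  shows "0 < \<alpha>" "\<alpha> < 1" "cf_rem \<alpha> i = (if even i then \<alpha> else 1 / (m + \<alpha>))"
proof -
  have m: "real m \<ge> 1" using assms(1) by simp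
  have "real m < sqrt (real m ^ 2 + 4 * real m)" using m by (intro real_less_rsqrt) auto
  then show a0: "0 < \<alpha>" using assms(2) by simp
  have "sqrt (real m ^ 2 + 4 * real m) < real m + 2"
    using m by (intro real_less_lsqrt) (auto simp: power2_eq_square algebra_simps)
  then show a1: "\<alpha> < 1" using assms(2) by simp
  have inv: "1 / \<alpha> = 1 + 1 / (m + \<alpha>)"
    using alpha_quadratic[OF assms(2)] a0 m by (simp add: field_simps)
  have r: "0 < 1 / (m + \<alpha>)" "1 / (m + \<alpha>) < 1" using a0 m by auto
  have *: "frac (1 / \<alpha>) = 1 / (m + \<alpha>)" using r inv by (simp add: frac_unique_iff)
  show "cf_rem \<alpha> i = (if even i then \<alpha> else 1 / (m + \<alpha>))"
    using * a0 a1 by (induction i) (auto simp: frac_unique_iff)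
qed

lemma cf_quot_periodic:
  fixes m :: nat and \<alpha> :: real
  assumes "m \<ge> 1" and "\<alpha> = (- real m + sqrt (real m ^ 2 + 4 * real m)) / 2"
  shows "cf_quot \<alpha> 0 = 0" "cf_quot \<alpha> (Suc i) = (if even i then 1 else int m)"
proof -
  note a = cf_rem_periodic[OF assms]
  show "cf_quot \<alpha> 0 = 0" using a(1,2) by (simp add: floor_eq_iff)
  have "1 / \<alpha> < 2"
  proof -
    note e = alpha_quadratic[OF assms(2)]
    have "\<alpha> > 1 / 2"
    proof (rule ccontr)
      assume "\<not> \<alpha> > 1 / 2"
      then have "\<alpha> * (\<alpha> + real m) \<le> 1 / 2 * (1 / 2 + real m)"
        using a(1) by (intro mult_mono) auto
      then show False using e assms(1) by simp
    qed
    then show ?thesis by (simp add: field_simps)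
  qed
  moreover have "1 \<le> 1 / \<alpha>" using a(1,2) by simp
  ultimately show "cf_quot \<alpha> (Suc i) = (if even i then 1 else int m)"
    using a by (auto simp: floor_eq_iff)
qed

lemma cf_denom_periodic:
  fixes m :: nat and \<alpha> :: real
  assumes "m \<ge> 1" and "\<alpha> = (- real m + sqrt (real m ^ 2 + 4 * real m)) / 2"
  shows "cf_denom \<alpha> 0 = 1" "cf_denom \<alpha> 1 = 1"
    "cf_denom \<alpha> (Suc (Suc i)) =
      (if even i then int m else 1) * cf_denom \<alpha> (Suc i) + cf_denom \<alpha> i"
  using cf_quot_periodic[OF assms] by (auto simp del: cf_quot.simps)

corollary ostrowski_ex1_periodic:
  fixes m :: nat and \<alpha> :: real
  assumes "m \<ge> 1" and "\<alpha> = (- real m + sqrt (real m ^ 2 + 4 * real m)) / 2"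
  shows "\<exists>!b. ostrowski_rep \<alpha> n b"
  using cf_quot_periodic[OF assms] assms(1) by (intro ostrowski_ex1) (auto simp del: cf_quot.simps)

end

theory Submission
  imports Defs "HOL-Analysis.Analysis"
begin

text \<open>
  By orthogonality of characters it suffices to save a power of \<open>N\<close> in the sums of
  \<open>\<zeta>^S\<^sub>q(n) \<omega>^S\<^sub>\<alpha>(n)\<close> over \<open>n < N\<close> for roots of unity \<open>(\<zeta>, \<omega>) \<noteq> (1, 1)\<close>.
  If \<open>\<zeta> = 1\<close>, the sums over \<open>n < q\<^sub>i\<close> obey a linear recursion with a contracting factor.
  If \<open>\<zeta> \<noteq> 1\<close>, then \<open>\<zeta>^(q-1) \<noteq> 1\<close>. Cut off the low Ostrowski digits, \<open>n = v + u\<close>, so that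
  \<open>S\<^sub>\<alpha>(n) = S\<^sub>\<alpha>(v) + S\<^sub>\<alpha>(u)\<close>, and apply Cauchy--Schwarz to the sum over \<open>v\<close>. The \<open>v\<close> have
  \<open>v\<alpha>\<close> close to an integer, and since \<open>\<alpha>\<close> is badly approximable, the set of all such \<open>v\<close>
  has at most a constant times the expected number of members in every residue class modulo
  \<open>M = q^l\<close>. This leaves a sum over \<open>r < M\<close> of squares of the convolution of \<open>\<zeta>^S\<^sub>q\<close> with a bounded
  function, which is small because the Fourier transform of \<open>\<zeta>^S\<^sub>q\<close> on \<open>\<int>/M\<close> is uniformly
  small: it is a product in which any two consecutive factors save a constant.
\<close>

section \<open>The sum of digits in base q\<close>

text \<open>Two terms suffice: a point of the unit circle other than 1 has \<open>Re x < 1\<close>,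
  so \<open>1 + x\<close> has norm below 2, and each remaining term has norm 1.\<close>

lemma norm_geometric_sum_less:
  fixes x :: complex
  assumes "norm x = 1" "x \<noteq> 1" "q \<ge> 2"
  shows "norm (\<Sum>d<q. x ^ d) < real q"
proof -
  have "Re x \<noteq> 1"
  proof
    assume "Re x = 1"
    moreover have "(Re x)\<^sup>2 + (Im x)\<^sup>2 = 1"
      using assms(1) by (simp add: cmod_def)
    ultimately show False
      using assms(2) by (simp add: complex_eq_iff)
  qed
  moreover have "Re x \<le> 1"
    using complex_Re_le_cmod[of x] assms(1) by simp
  ultimately have "Re x < 1" by simp
  moreover have "(norm (1 + x))\<^sup>2 = 2 + 2 * Re x"
    using assms(1) unfolding cmod_power2 by (simp add: cmod_def power2_eq_square algebra_simps)
  ultimately have "(norm (1 + x))\<^sup>2 < 2\<^sup>2" by simp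
  then have two: "norm (1 + x) < 2"
    by (rule power_less_imp_less_base) simp
  obtain p where p: "q = Suc (Suc p)"
    using assms(3) by (metis add_2_eq_Suc le_Suc_ex)
  have "(\<Sum>d<q. x ^ d) = (1 + x) + (\<Sum>d<p. x ^ Suc (Suc d))"
    unfolding p sum.lessThan_Suc_shift by simp
  also have "norm \<dots> \<le> norm (1 + x) + (\<Sum>d<p. norm (x ^ Suc (Suc d)))"
    by (rule order_trans[OF norm_triangle_ineq add_left_mono[OF norm_sum]])
  also have "(\<Sum>d<p. norm (x ^ Suc (Suc d))) = real p"
    using assms(1) by (simp add: norm_power norm_mult)
  finally show ?thesis using two p by simp
qed

lemma digit_sum_rec:
  assumes "q \<ge> 2" "d < q"
  shows "digit_sum q (q * a + d) = digit_sum q a + d"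
proof -
  \<comment> \<open>The summation range in \<open>digit_sum\<close> depends on \<open>n\<close>. All
    terms beyond it vanish, so it may be enlarged at will, which permits the index shift
    below.\<close>
  have eq: "digit_sum q n = (\<Sum>i\<le>K. n div q ^ i mod q)" if "n \<le> K" for n K
    unfolding digit_sum_def
  proof (rule sum.mono_neutral_left)
    show "{i. q ^ i \<le> n} \<subseteq> {..K}"
    proof safe
      fix i assume "q ^ i \<le> n"
      moreover have "i < q ^ i" using less_exp[of i] power_mono[OF assms(1), of i] by linarith
      ultimately show "i \<le> K" using that by simp
    qed
  qed (auto simp: not_le)
  define n where "n = q * a + d"
  have "a \<le> n" using assms mult_le_mono1[of 1 q a] unfolding n_def by linarith
  have "digit_sum q n = (\<Sum>i\<le>Suc n. n div q ^ i mod q)" by (rule eq) simp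
  also have "\<dots> = n mod q + (\<Sum>i\<le>n. n div q ^ Suc i mod q)"
    by (subst sum.atMost_Suc_shift) simp
  also have "n mod q = d" using assms by (simp add: n_def)
  also have "(\<Sum>i\<le>n. n div q ^ Suc i mod q) = (\<Sum>i\<le>n. a div q ^ i mod q)"
    using assms by (intro sum.cong) (auto simp: n_def div_mult2_eq)
  also have "\<dots> = digit_sum q a" using eq[OF \<open>a \<le> n\<close>] by simp
  finally show ?thesis by (simp add: n_def)
qed

lemma digit_sum_0: "digit_sum q 0 = 0"
  by (simp add: digit_sum_def)

text \<open>\<open>c\<close> and \<open>r\<close> occupy disjoint digit positions. The induction
  strips the lowest digit off \<open>r\<close>.\<close>

lemma digit_sum_split:
  assumes "q \<ge> 2" "r < q ^ l"
  shows "digit_sum q (q ^ l * c + r) = digit_sum q c + digit_sum q r"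
  using assms(2)
proof (induction l arbitrary: r)
  case (Suc l)
  have r: "r = q * (r div q) + r mod q" "r mod q < q" "r div q < q ^ l"
    using Suc.prems assms(1) by (auto simp: less_mult_imp_div_less mult.commute)
  have "digit_sum q (q ^ Suc l * c + r) = digit_sum q (q * (q ^ l * c + r div q) + r mod q)"
    using r(1) by (simp add: algebra_simps)
  also have "\<dots> = digit_sum q c + (digit_sum q (r div q) + r mod q)"
    using digit_sum_rec[OF assms(1) r(2)] Suc.IH[OF r(3)] by simp
  also have "digit_sum q (r div q) + r mod q = digit_sum q r"
    using digit_sum_rec[OF assms(1) r(2), of "r div q"] r(1) by simp
  finally show ?case .
qed (simp add: digit_sum_0)

lemma sum_lessThan_mult:
  fixes h :: "nat \<Rightarrow> 'a :: comm_monoid_add"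
  shows "(\<Sum>n<q * k. h n) = (\<Sum>c<k. \<Sum>d<q. h (q * c + d))"
proof (induction k)
  case (Suc k)
  have "(\<Sum>n<q * Suc k. h n) = (\<Sum>n<q * k. h n) + (\<Sum>n=q*k..<q*k+q. h n)"
    by (simp add: lessThan_atLeast0 sum.atLeastLessThan_concat add.commute)
  also have "(\<Sum>n=q*k..<q*k+q. h n) = (\<Sum>d<q. h (q * k + d))"
    using sum.shift_bounds_nat_ivl[of h 0 "q * k" q] by (simp add: lessThan_atLeast0 add.commute)
  finally show ?case using Suc by simp
qed simp

text \<open>
  If the factor at \<open>x = \<zeta> z\<close> is extremal then \<open>x = 1\<close>, and the next factor sits at
  \<open>y = \<zeta> z\<^sup>q = \<zeta>\<^sup>1\<^sup>-\<^sup>q \<noteq> 1\<close>; so any two consecutive factors save a constant.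
\<close>

lemma consecutive_factors_saving:
  fixes \<zeta> :: complex
  assumes "q \<ge> 2" "norm \<zeta> = 1" "\<zeta> ^ (q - 1) \<noteq> 1"
  obtains \<mu> :: real where "0 < \<mu>" "\<mu> < 1" "1 \<le> q * \<mu>"
    "\<And>x y. norm x = 1 \<Longrightarrow> y * \<zeta> ^ (q - 1) = x ^ q \<Longrightarrow>
       norm (\<Sum>d<q. x ^ d) * norm (\<Sum>d<q. y ^ d) \<le> (\<mu> * q)\<^sup>2"
proof -
  define \<phi> where "\<phi> x = (\<Sum>d<q. x ^ d)" for x :: complex
  define F where "F x = norm (\<phi> x) * norm (\<phi> (x ^ q / \<zeta> ^ (q - 1)))" for x
  have z0: "\<zeta> \<noteq> 0" using assms(2) by auto
  have le: "norm (\<phi> x) \<le> q" if "norm x = 1" for x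
    unfolding \<phi>_def using norm_sum[of "\<lambda>d. x ^ d" "{..<q}"] that by (simp add: norm_power)
  \<comment> \<open>Compactness of the circle makes the saving uniform: it is enough to check strict
    inequality at one maximum point of \<open>F\<close>.\<close>
  have "continuous_on (sphere 0 1) F"
    unfolding F_def \<phi>_def by (intro continuous_intros) (use z0 in auto)
  moreover have "sphere (0::complex) 1 \<noteq> {}" by simp
  ultimately obtain x0 where x0: "norm x0 = 1" "\<And>x. norm x = 1 \<Longrightarrow> F x \<le> F x0"
    using continuous_attains_sup[OF compact_sphere, of 0 1 F] by auto
  have nz: "norm (x0 ^ q / \<zeta> ^ (q - 1)) = 1"
    using x0(1) assms(2) by (simp add: norm_divide norm_power)
  have "F x0 < real q * real q"
  proof (cases "x0 = 1")
    case True
    then have "norm (\<phi> (x0 ^ q / \<zeta> ^ (q - 1))) < q"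
      using norm_geometric_sum_less[OF nz _ assms(1)] assms(3) by (simp add: \<phi>_def)
    moreover have "F x0 \<le> q * norm (\<phi> (x0 ^ q / \<zeta> ^ (q - 1)))"
      unfolding F_def using le[OF x0(1)] by (intro mult_right_mono) auto
    ultimately show ?thesis
      using assms(1) by (auto elim!: le_less_trans)
  next
    case False
    then have "norm (\<phi> x0) < q"
      using norm_geometric_sum_less[OF x0(1) _ assms(1)] by (simp add: \<phi>_def)
    moreover have "F x0 \<le> norm (\<phi> x0) * q"
      unfolding F_def using le[OF nz] by (intro mult_left_mono) auto
    ultimately show ?thesis
      using assms(1) by (auto elim!: le_less_trans)
  qed
  then have F1: "F x0 / q\<^sup>2 < 1" using assms(1) by (simp add: power2_eq_square)
  \<comment> \<open>The lower bound 1/2 keeps \<open>\<mu>\<close> positive and, as q \<ge> 2, makes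
    \<open>q * \<mu>\<close> at least 1.\<close>
  define \<mu> where "\<mu> = max (1/2) (sqrt (F x0 / q\<^sup>2))"
  have F0: "F x0 / q\<^sup>2 \<ge> 0" unfolding F_def by simp
  then have "F x0 / q\<^sup>2 = (sqrt (F x0 / q\<^sup>2))\<^sup>2" by (rule real_sqrt_pow2[symmetric])
  also have "\<dots> \<le> \<mu>\<^sup>2" unfolding \<mu>_def using F0 by (intro power_mono) (auto simp: real_sqrt_ge_zero)
  finally have Fle: "F x0 \<le> (\<mu> * q)\<^sup>2" using assms(1) by (simp add: field_simps)
  show ?thesis
  proof (rule that[of \<mu>])
    show "0 < \<mu>" unfolding \<mu>_def by simp
    show "\<mu> < 1" unfolding \<mu>_def using F1 by (simp add: real_sqrt_lt_1_iff)
    have "2 * (1/2) \<le> real q * \<mu>"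
      using assms(1) unfolding \<mu>_def by (intro mult_mono) auto
    then show "1 \<le> real q * \<mu>" by simp
    fix x y :: complex
    assume x: "norm x = 1" and y: "y * \<zeta> ^ (q - 1) = x ^ q"
    have "y = x ^ q / \<zeta> ^ (q - 1)" using y z0 by (simp add: field_simps)
    then show "norm (\<Sum>d<q. x ^ d) * norm (\<Sum>d<q. y ^ d) \<le> (\<mu> * q)\<^sup>2"
      using x0(2)[OF x] Fle unfolding F_def \<phi>_def by simp
  qed
qed

text \<open>At the \<open>q ^ l\<close>-th roots of unity these are the unnormalised Fourier
  coefficients of \<open>\<zeta> ^ digit_sum q r\<close> on \<int>/\<open>q ^ l\<close>. A free
  argument \<open>z\<close> is kept because the recursion replaces \<open>z\<close> by
  \<open>z ^ q\<close>.\<close>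

definition digit_poly :: "nat \<Rightarrow> complex \<Rightarrow> nat \<Rightarrow> complex \<Rightarrow> complex" where
  "digit_poly q \<zeta> l z = (\<Sum>r<q ^ l. \<zeta> ^ digit_sum q r * z ^ r)"

text \<open>The lowest digit is split off. Iterating this exhibits \<open>digit_poly\<close> as a
  product of geometric sums at the points \<open>\<zeta> * z ^ (q ^ i)\<close>.\<close>

lemma digit_poly_Suc:
  assumes "q \<ge> 2"
  shows "digit_poly q \<zeta> (Suc l) z = (\<Sum>d<q. (\<zeta> * z) ^ d) * digit_poly q \<zeta> l (z ^ q)"
proof -
  have "digit_poly q \<zeta> (Suc l) z
      = (\<Sum>c<q ^ l. \<Sum>d<q. \<zeta> ^ digit_sum q (q * c + d) * z ^ (q * c + d))"
    unfolding digit_poly_def power_Suc sum_lessThan_mult ..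
  also have "\<dots> = (\<Sum>c<q ^ l. \<Sum>d<q. (\<zeta> * z) ^ d * (\<zeta> ^ digit_sum q c * (z ^ q) ^ c))"
  proof (intro sum.cong refl)
    fix c d assume "d \<in> {..<q}"
    then have "digit_sum q (q * c + d) = digit_sum q c + d"
      using digit_sum_rec assms by auto
    moreover have "z ^ (q * c + d) = (z ^ q) ^ c * z ^ d"
      by (simp add: power_add power_mult)
    ultimately show "\<zeta> ^ digit_sum q (q * c + d) * z ^ (q * c + d)
        = (\<zeta> * z) ^ d * (\<zeta> ^ digit_sum q c * (z ^ q) ^ c)"
      by (simp only: power_add power_mult_distrib mult_ac)
  qed
  also have "\<dots> = (\<Sum>d<q. (\<zeta> * z) ^ d) * digit_poly q \<zeta> l (z ^ q)"
    unfolding digit_poly_def by (subst sum.swap) (simp add: sum_product)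
  finally show ?thesis .
qed

text \<open>The induction goes in steps of two, since only pairs of consecutive factors are known to
  save. The loss \<open>1 / \<mu>\<close> pays for the unpaired factor when \<open>l\<close> is
  odd.\<close>

lemma norm_digit_poly_bound:
  fixes \<zeta> :: complex
  assumes "q \<ge> 2" "norm \<zeta> = 1" "0 < \<mu>" "\<mu> < 1"
    and sav: "\<And>x y. norm x = 1 \<Longrightarrow> y * \<zeta> ^ (q - 1) = x ^ q \<Longrightarrow>
       norm (\<Sum>d<q. x ^ d) * norm (\<Sum>d<q. y ^ d) \<le> (\<mu> * q)\<^sup>2"
    and "norm z = 1"
  shows "norm (digit_poly q \<zeta> l z) \<le> (\<mu> * q) ^ l / \<mu>"
  using assms(6)
proof (induction l arbitrary: z rule: less_induct)
  case (less l)
  consider "l = 0" | "l = 1" | k where "l = Suc (Suc k)"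
    by (metis One_nat_def not0_implies_Suc)
  then show ?case
  proof cases
    case 1
    then show ?thesis using assms by (simp add: digit_poly_def digit_sum_0)
  next
    case 2
    have "norm (digit_poly q \<zeta> 1 z) \<le> (\<Sum>r<q. norm (\<zeta> ^ digit_sum q r * z ^ r))"
      unfolding digit_poly_def using norm_sum by fastforce
    also have "\<dots> = q" using less.prems assms(2) by (simp add: norm_mult norm_power)
    finally show ?thesis using 2 assms by simp
  next
    case (3 k)
    \<comment> \<open>This is the relation demanded by \<open>sav\<close>, for the consecutive
      arguments \<open>\<zeta> * z\<close> and \<open>\<zeta> * z ^ q\<close>.\<close>
    have "\<zeta> * z ^ q * \<zeta> ^ (q - 1) = (\<zeta> * z) ^ q"
      using assms(1) by (cases q) (simp_all add: power_mult_distrib mult_ac)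
    then have s: "norm (\<Sum>d<q. (\<zeta> * z) ^ d) * norm (\<Sum>d<q. (\<zeta> * z ^ q) ^ d) \<le> (\<mu> * q)\<^sup>2"
      using less.prems assms(2) by (intro sav) (simp_all add: norm_mult)
    have "norm ((z ^ q) ^ q) = 1" using less.prems by (simp add: norm_power)
    then have IH: "norm (digit_poly q \<zeta> k ((z ^ q) ^ q)) \<le> (\<mu> * q) ^ k / \<mu>"
      using less.IH 3 by auto
    have "norm (digit_poly q \<zeta> l z) = (norm (\<Sum>d<q. (\<zeta> * z) ^ d) * norm (\<Sum>d<q. (\<zeta> * z ^ q) ^ d))
        * norm (digit_poly q \<zeta> k ((z ^ q) ^ q))"
      using 3 assms(1) by (simp only: digit_poly_Suc norm_mult mult.assoc)
    also have "\<dots> \<le> (\<mu> * q)\<^sup>2 * ((\<mu> * q) ^ k / \<mu>)"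
      using s IH by (intro mult_mono) auto
    finally show ?thesis using 3 by (simp add: power2_eq_square mult.assoc)
  qed
qed

section \<open>Fourier analysis modulo M\<close>

lemma primitive_root_of_unity:
  assumes "M > 0"
  defines "w \<equiv> cis (2 * pi / real M)"
  shows "norm w = 1" "w ^ M = 1" "\<And>k. 0 < k \<Longrightarrow> k < M \<Longrightarrow> w ^ k \<noteq> 1"
proof -
  show "norm w = 1" by (simp add: w_def)
  show "w ^ M = 1" unfolding w_def Complex.DeMoivre using assms(1) by simp
  fix k assume k: "0 < k" "k < M"
  show "w ^ k \<noteq> 1"
  proof
    assume "w ^ k = 1"
    then have "cos (k * (2 * pi / M)) = 1"
      unfolding w_def Complex.DeMoivre by (simp add: complex_eq_iff)
    then obtain n :: int where n: "k * (2 * pi / M) = of_int n * 2 * pi"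
      by (auto simp: cos_one_2pi_int)
    then have "real k = of_int n * real M" using assms(1) by (simp add: field_simps)
    then have "int k = n * int M" by (metis of_int_eq_iff of_int_mult of_int_of_nat_eq)
    then show False using k by (metis dvd_triv_right int_dvd_int_iff nat_dvd_not_less)
  qed
qed

lemma root_of_unity_power_mod:
  fixes w :: complex
  assumes "w ^ M = 1"
  shows "w ^ (n mod M) = w ^ n"
proof -
  have "w ^ n = w ^ (M * (n div M) + n mod M)" by simp
  also have "\<dots> = w ^ (n mod M)" using assms by (simp only: power_add power_mult) simp
  finally show ?thesis by simp
qed

text \<open>The sum is geometric with ratio \<open>\<xi>\<close>, an \<open>M\<close>-th root of
  unity that equals 1 exactly when \<open>u\<close> and \<open>v\<close> are congruent.\<close>

lemma root_of_unity_orthogonality: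
  fixes w :: complex
  assumes M: "M > 0" and w: "norm w = 1" "w ^ M = 1" "\<And>k. 0 < k \<Longrightarrow> k < M \<Longrightarrow> w ^ k \<noteq> 1"
  shows "(\<Sum>t<M. w ^ (t * u) * cnj (w ^ (t * v))) = (if u mod M = v mod M then of_nat M else 0)"
proof -
  have w0: "w \<noteq> 0" using w(1) by auto
  have cw: "cnj w = 1 / w" using w(1) w0 by (simp add: divide_conv_cnj)
  define \<xi> where "\<xi> = w ^ u / w ^ v"
  have eq: "(\<Sum>t<M. w ^ (t * u) * cnj (w ^ (t * v))) = (\<Sum>t<M. \<xi> ^ t)"
    by (intro sum.cong refl)
       (simp add: \<xi>_def cw power_divide power_mult[symmetric] mult.commute)
  have \<xi>: "\<xi> = w ^ (u mod M) / w ^ (v mod M)"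
    unfolding \<xi>_def root_of_unity_power_mod[OF w(2)] ..
  show ?thesis
  proof (cases "u mod M = v mod M")
    case True
    then show ?thesis unfolding eq \<xi> using w0 by simp
  next
    case False
    have "w ^ i \<noteq> w ^ j" if "i < j" "j < M" for i j
    proof
      have "w ^ j = w ^ i * w ^ (j - i)"
        using that by (simp add: power_add[symmetric])
      moreover assume "w ^ i = w ^ j"
      ultimately show False using w(3)[of "j - i"] that w0 by simp
    qed
    moreover have "u mod M < M" "v mod M < M" using M by auto
    ultimately have "w ^ (u mod M) \<noteq> w ^ (v mod M)" using False by (metis linorder_neqE_nat)
    then have "\<xi> \<noteq> 1" using w0 by (simp add: \<xi>)
    moreover have "\<xi> ^ M = 1"
    proof -
      have "\<xi> ^ M = (w ^ M) ^ u / (w ^ M) ^ v"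
        unfolding \<xi>_def power_divide power_mult[symmetric] by (simp add: mult.commute)
      then show ?thesis using w(2) by simp
    qed
    ultimately show ?thesis unfolding eq using False by (simp add: geometric_sum)
  qed
qed

text \<open>After the squares are expanded, summing over \<open>t\<close> first leaves only the
  diagonal, by orthogonality.\<close>

lemma plancherel_mod:
  fixes x :: "nat \<Rightarrow> complex"
  assumes M: "M > 0" and w: "norm w = 1" "w ^ M = 1" "\<And>k. 0 < k \<Longrightarrow> k < M \<Longrightarrow> w ^ k \<noteq> 1"
  shows "(\<Sum>t<M. (norm (\<Sum>u<M. x u * w ^ (t * u)))\<^sup>2) = M * (\<Sum>u<M. (norm (x u))\<^sup>2)"
proof -
  have "complex_of_real (\<Sum>t<M. (norm (\<Sum>u<M. x u * w ^ (t * u)))\<^sup>2)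
      = (\<Sum>t<M. \<Sum>u<M. \<Sum>v<M. x u * cnj (x v) * (w ^ (t * u) * cnj (w ^ (t * v))))"
    by (simp only: of_real_sum complex_norm_square cnj_sum complex_cnj_mult sum_product)
       (intro sum.cong refl, simp add: mult_ac)
  also have "\<dots> = (\<Sum>u<M. \<Sum>v<M. \<Sum>t<M. x u * cnj (x v) * (w ^ (t * u) * cnj (w ^ (t * v))))"
    by (subst sum.swap) (rule sum.cong[OF refl], rule sum.swap)
  also have "\<dots> = (\<Sum>u<M. \<Sum>v<M. if u = v then x u * cnj (x v) * of_nat M else 0)"
    by (intro sum.cong refl, subst sum_distrib_left[symmetric], subst root_of_unity_orthogonality[OF M w]) auto
  also have "\<dots> = complex_of_real (M * (\<Sum>u<M. (norm (x u))\<^sup>2))"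
    by (simp add: sum_distrib_left mult.commute complex_norm_square del: of_real_power)
  finally show ?thesis unfolding of_real_eq_iff .
qed

lemma sum_shift_mod:
  fixes h :: "nat \<Rightarrow> 'a :: comm_monoid_add"
  assumes "M > 0"
  shows "(\<Sum>r<M. h ((r + u) mod M)) = (\<Sum>r<M. h r)"
proof (rule sum.reindex_bij_betw)
  have inj: "inj_on (\<lambda>r. (r + u) mod M) {..<M}"
  proof (rule inj_onI)
    fix r s assume rs: "r \<in> {..<M}" "s \<in> {..<M}" "(r + u) mod M = (s + u) mod M"
    then have "[r + u = s + u] (mod M)" by (simp add: unique_euclidean_semiring_class.cong_def)
    then have "[r = s] (mod M)" by (simp only: cong_add_rcancel_nat)
    then show "r = s" using rs by (simp add: unique_euclidean_semiring_class.cong_def)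
  qed
  moreover have "(\<lambda>r. (r + u) mod M) ` {..<M} \<subseteq> {..<M}" using assms by auto
  ultimately show "bij_betw (\<lambda>r. (r + u) mod M) {..<M} {..<M}"
    by (simp add: bij_betw_def endo_inj_surj)
qed

text \<open>
  A circulant matrix is diagonalised by the Fourier transform on \<open>\<int>/M\<close>.
\<close>

lemma circulant_norm_bound:
  fixes a g :: "nat \<Rightarrow> complex"
  assumes M: "M > 0" and F: "\<And>z. norm z = 1 \<Longrightarrow> norm (\<Sum>x<M. a x * z ^ x) \<le> F"
  shows "(\<Sum>r<M. (norm (\<Sum>u<M. a ((r + u) mod M) * g u))\<^sup>2) \<le> F\<^sup>2 * (\<Sum>u<M. (norm (g u))\<^sup>2)"
proof -
  define w where "w = cis (2 * pi / real M)"
  note w = primitive_root_of_unity[OF M, folded w_def]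
  have cw: "cnj w * w = 1"
    using complex_norm_square[of w] w(1) by (simp add: mult.commute)
  define y where "y r = (\<Sum>u<M. a ((r + u) mod M) * g u)" for r
  have wmod: "w ^ (t * (n mod M)) = w ^ (t * n)" for t n
    using root_of_unity_power_mod[OF w(2), of n] by (metis mult.commute power_mult)
  \<comment> \<open>The matrix depends on \<open>r + u\<close> rather than \<open>r - u\<close>, so
    this is a correlation. Substituting \<open>r + u\<close> for \<open>r\<close> factors its
    transform, with a conjugate on the side of \<open>g\<close>.\<close>
  have dft: "(\<Sum>r<M. y r * w ^ (t * r))
      = (\<Sum>x<M. a x * w ^ (t * x)) * cnj (\<Sum>u<M. cnj (g u) * w ^ (t * u))" for t
  proof -
    have "(\<Sum>r<M. y r * w ^ (t * r)) = (\<Sum>u<M. \<Sum>r<M. a ((r + u) mod M) * g u * w ^ (t * r))"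
      unfolding y_def sum_distrib_right by (rule sum.swap)
    also have "\<dots> = (\<Sum>u<M. \<Sum>r<M. g u * cnj w ^ (t * u)
        * (a ((r + u) mod M) * w ^ (t * ((r + u) mod M))))"
    proof (intro sum.cong refl)
      fix u r
      have "w ^ (t * r) = (cnj w * w) ^ (t * u) * w ^ (t * r)" using cw by simp
      also have "\<dots> = cnj w ^ (t * u) * w ^ (t * (r + u))"
        by (simp add: power_mult_distrib power_add distrib_left)
      finally show "a ((r + u) mod M) * g u * w ^ (t * r) =
        g u * cnj w ^ (t * u) * (a ((r + u) mod M) * w ^ (t * ((r + u) mod M)))"
        unfolding wmod by simp
    qed
    also have "\<dots> = (\<Sum>u<M. g u * cnj w ^ (t * u) * (\<Sum>x<M. a x * w ^ (t * x)))"
      by (simp only: sum_distrib_left[symmetric] sum_shift_mod[OF M, of "\<lambda>x. a x * w ^ (t * x)"])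
    also have "\<dots> = (\<Sum>u<M. g u * cnj w ^ (t * u)) * (\<Sum>x<M. a x * w ^ (t * x))"
      by (rule sum_distrib_right[symmetric])
    finally show ?thesis by (simp add: mult.commute)
  qed
  have "M * (\<Sum>r<M. (norm (y r))\<^sup>2) = (\<Sum>t<M. (norm (\<Sum>r<M. y r * w ^ (t * r)))\<^sup>2)"
    using plancherel_mod[OF M w] by simp
  also have "\<dots> \<le> (\<Sum>t<M. F\<^sup>2 * (norm (\<Sum>u<M. cnj (g u) * w ^ (t * u)))\<^sup>2)"
  proof (intro sum_mono)
    fix t
    have "norm (\<Sum>x<M. a x * w ^ (t * x)) \<le> F"
      using F[of "w ^ t"] w(1) by (simp add: power_mult norm_power)
    then have "(norm (\<Sum>x<M. a x * w ^ (t * x)))\<^sup>2 \<le> F\<^sup>2"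
      by (intro power_mono) auto
    then show "(norm (\<Sum>r<M. y r * w ^ (t * r)))\<^sup>2 \<le> F\<^sup>2 * (norm (\<Sum>u<M. cnj (g u) * w ^ (t * u)))\<^sup>2"
      unfolding dft norm_mult power_mult_distrib complex_mod_cnj by (rule mult_right_mono) simp
  qed
  also have "\<dots> = F\<^sup>2 * (M * (\<Sum>u<M. (norm (g u))\<^sup>2))"
    using plancherel_mod[OF M w, of "\<lambda>u. cnj (g u)"] by (simp add: sum_distrib_left[symmetric])
  finally have "M * (\<Sum>r<M. (norm (y r))\<^sup>2) \<le> M * (F\<^sup>2 * (\<Sum>u<M. (norm (g u))\<^sup>2))"
    by (simp add: mult_ac)
  then show ?thesis using M unfolding y_def by simp
qed

text \<open>The \<open>n\<close> are grouped by residue modulo \<open>M\<close>, at most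
  \<open>K\<close> in each class. As long as adding \<open>u\<close> causes no carry past position
  \<open>l\<close>, the higher digits contribute a common factor of norm 1, so the inner sum depends
  in norm only on the residue and the circulant bound applies. At most \<open>L\<close> residues
  admit a carry; the trivial bound there costs \<open>L ^ 2\<close> each, whence
  \<open>L ^ 3\<close>.\<close>

lemma shifted_digit_sum_quadratic_bound:
  fixes \<zeta> :: complex and g :: "nat \<Rightarrow> complex"
  assumes q: "q \<ge> 2" and \<zeta>: "norm \<zeta> = 1" and M: "M = q ^ l"
    and F: "\<And>z. norm z = 1 \<Longrightarrow> norm (digit_poly q \<zeta> l z) \<le> F"
    and g: "\<And>u. norm (g u) \<le> 1"
    and W: "finite W" and K: "\<And>r. r < M \<Longrightarrow> real (card {n \<in> W. n mod M = r}) \<le> K"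
  shows "(\<Sum>n\<in>W. (norm (\<Sum>u<L. \<zeta> ^ digit_sum q (n + u) * g u))\<^sup>2)
           \<le> K * (F\<^sup>2 * real L + real L ^ 3)"
proof -
  define f where "f n = \<zeta> ^ digit_sum q n" for n
  have nf: "norm (f n) = 1" for n by (simp add: f_def \<zeta> norm_power)
  have M0: "M > 0" using q M by simp
  have K0: "K \<ge> 0" using K[OF M0] by (meson of_nat_0_le_iff order_trans)
  have triv: "norm (\<Sum>u<L. f (n + u) * g u) \<le> L" for n
  proof -
    have "norm (\<Sum>u<L. f (n + u) * g u) \<le> (\<Sum>u<L. 1)"
      by (rule order_trans[OF norm_sum sum_mono]) (simp add: norm_mult nf g)
    then show ?thesis by simp
  qed
  have group: "(\<Sum>n\<in>W. h (n mod M)) \<le> K * (\<Sum>r<M. h r)" if "\<And>r. h r \<ge> 0" for h :: "nat \<Rightarrow> real"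
  proof -
    have "(\<Sum>n\<in>W. h (n mod M)) = (\<Sum>r<M. \<Sum>n\<in>{n \<in> W. n mod M = r}. h (n mod M))"
      using W M0 by (intro sum.group[symmetric]) auto
    also have "\<dots> = (\<Sum>r<M. real (card {n \<in> W. n mod M = r}) * h r)"
      by (intro sum.cong refl) simp
    also have "\<dots> \<le> (\<Sum>r<M. K * h r)"
      using K that by (intro sum_mono mult_right_mono) auto
    finally show ?thesis by (simp add: sum_distrib_left)
  qed
  show ?thesis
  proof (cases "L \<le> M")
    \<comment> \<open>For \<open>L > M\<close> the trivial bound suffices, as
      \<open>M * L ^ 2\<close> is below \<open>L ^ 3\<close>.\<close>
    case False
    have "(\<Sum>n\<in>W. (norm (\<Sum>u<L. f (n + u) * g u))\<^sup>2) \<le> (\<Sum>n\<in>W. (real L)\<^sup>2)"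
      using triv by (intro sum_mono power_mono) auto
    also have "\<dots> \<le> K * (\<Sum>r<M. (real L)\<^sup>2)" by (rule group) simp
    also have "\<dots> = K * (M * (real L)\<^sup>2)" by simp
    also have "M * (real L)\<^sup>2 \<le> real L ^ 3"
      using False by (simp add: power3_eq_cube power2_eq_square mult_right_mono)
    also have "\<dots> \<le> F\<^sup>2 * real L + real L ^ 3" by simp
    finally show ?thesis using K0 unfolding f_def by (simp add: mult_left_mono)
  next
    case True
    define A where "A r = norm (\<Sum>u<L. f ((r + u) mod M) * g u)" for r
    define h where "h r = (A r)\<^sup>2 + (if r + L > M then (real L)\<^sup>2 else 0)" for r
    have "(norm (\<Sum>u<L. f (n + u) * g u))\<^sup>2 \<le> h (n mod M)" for n
    proof (cases "n mod M + L > M")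
      case True
      have "(norm (\<Sum>u<L. f (n + u) * g u))\<^sup>2 \<le> (real L)\<^sup>2"
        using triv by (intro power_mono) auto
      then show ?thesis using True unfolding h_def by (simp add: add_increasing)
    next
      case False
      have "f (n + u) = f (n div M) * f ((n mod M + u) mod M)" if "u < L" for u
      proof -
        have lt: "n mod M + u < q ^ l" using False that M by simp
        have "n + u = q ^ l * (n div M) + (n mod M + u)" using M by simp
        then have "digit_sum q (n + u) = digit_sum q (n div M) + digit_sum q (n mod M + u)"
          using digit_sum_split[OF q lt] by metis
        then show ?thesis using lt M by (simp add: f_def power_add)
      qed
      then have "(\<Sum>u<L. f (n + u) * g u)
          = f (n div M) * (\<Sum>u<L. f ((n mod M + u) mod M) * g u)"
        by (simp add: sum_distrib_left mult.assoc)
      then have "norm (\<Sum>u<L. f (n + u) * g u) = A (n mod M)"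
        by (simp add: norm_mult nf A_def)
      then show ?thesis unfolding h_def by simp
    qed
    then have "(\<Sum>n\<in>W. (norm (\<Sum>u<L. f (n + u) * g u))\<^sup>2) \<le> (\<Sum>n\<in>W. h (n mod M))"
      by (intro sum_mono) auto
    also have "\<dots> \<le> K * (\<Sum>r<M. h r)" by (rule group) (simp add: h_def)
    also have "(\<Sum>r<M. h r) \<le> F\<^sup>2 * real L + real L ^ 3"
    proof -
      \<comment> \<open>Padding \<open>g\<close> with zeros up to \<open>M\<close> makes the matrix
        square, as the circulant bound requires.\<close>
      define g' where "g' u = (if u < L then g u else 0)" for u
      have ext: "(\<Sum>u<M. h u * g' u) = (\<Sum>u<L. h u * g u)" for h
        using True by (intro sum.mono_neutral_cong_right) (auto simp: g'_def)
      have "(\<Sum>r<M. (A r)\<^sup>2) = (\<Sum>r<M. (norm (\<Sum>u<M. f ((r + u) mod M) * g' u))\<^sup>2)"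
        unfolding A_def ext ..
      also have "\<dots> \<le> F\<^sup>2 * (\<Sum>u<M. (norm (g' u))\<^sup>2)"
        using F unfolding digit_poly_def M[symmetric] f_def[symmetric]
        by (intro circulant_norm_bound M0)
      also have "(\<Sum>u<M. (norm (g' u))\<^sup>2) = (\<Sum>u<L. (norm (g u))\<^sup>2)"
        using True by (intro sum.mono_neutral_cong_right) (auto simp: g'_def)
      also have "\<dots> \<le> (\<Sum>u<L. 1)"
        using g by (intro sum_mono) (simp add: power_le_one)
      finally have 1: "(\<Sum>r<M. (A r)\<^sup>2) \<le> F\<^sup>2 * real L" by (simp add: mult_left_mono)
      have "(\<Sum>r<M. if r + L > M then (real L)\<^sup>2 else 0) = (\<Sum>r\<in>{r. r < M \<and> r + L > M}. (real L)\<^sup>2)"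
        by (intro sum.mono_neutral_cong_right) auto
      also have "\<dots> = real (card {r. r < M \<and> r + L > M}) * (real L)\<^sup>2" by simp
      also have "card {r. r < M \<and> r + L > M} \<le> card {M - L..<M}"
        by (intro card_mono) auto
      then have "real (card {r. r < M \<and> r + L > M}) * (real L)\<^sup>2 \<le> real L * (real L)\<^sup>2"
        using True by (intro mult_right_mono) auto
      finally show ?thesis using 1 unfolding h_def sum.distrib
        by (simp add: power3_eq_cube power2_eq_square)
    qed
    finally show ?thesis using K0 unfolding f_def by (simp add: mult_left_mono)
  qed
qed

section \<open>Rotations of the circle\<close>

text \<open>The mean value theorem is applied at the half angle, where the cosine is at least 1/2;
  the doubling formula then gives back \<open>x\<close>.\<close>

lemma sin_ge_quarter:
  assumes "0 \<le> x" "x \<le> pi / 2"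
  shows "x / 4 \<le> sin x"
proof (cases "x = 0")
  case False
  have "\<exists>z. 0 < z \<and> z < x / 2 \<and> sin (x / 2) - sin 0 = (x / 2 - 0) * cos z"
    using assms False by (intro MVT2) (auto intro!: derivative_eq_intros)
  then obtain z where z: "0 < z" "z < x / 2" "sin (x / 2) = x / 2 * cos z" by auto
  have c: "cos y \<ge> 1/2" if "0 \<le> y" "y \<le> x / 2" for y
    using cos_monotone_0_pi_le[of y "pi / 3"] that assms by (simp add: cos_60)
  have "x / 2 * (1/2) \<le> sin (x / 2)"
    unfolding z(3) using assms c[of z] z by (intro mult_left_mono) auto
  then have "2 * (x / 4) * (1/2) \<le> 2 * sin (x / 2) * cos (x / 2)"
    using assms c[of "x / 2"] by (intro mult_mono) auto
  also have "\<dots> = sin (2 * (x / 2))" by (rule sin_double[symmetric])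
  finally show ?thesis by simp
qed simp

text \<open>The norm equals \<open>2 * \<bar>sin (pi * y)\<bar>\<close>, which depends only on the
  distance \<open>t\<close> of \<open>y\<close> from the nearest integer and is at least
  \<open>t\<close>.\<close>

lemma norm_one_minus_cis_ge:
  fixes d y :: real
  assumes "\<And>p::int. d \<le> \<bar>y - p\<bar>"
  shows "d \<le> norm (1 - cis (2 * pi * y))"
proof -
  define t where "t = \<bar>y - round y\<bar>"
  have t: "0 \<le> t" "t \<le> 1/2" "d \<le> t"
    using assms[of "round y"] of_int_round_abs_le[of y] by (auto simp: t_def abs_minus_commute)
  have "sin (pi * (y - round y)) = sin (pi * y) \<or> sin (pi * (y - round y)) = - sin (pi * y)"
    by (simp add: right_diff_distrib sin_diff sin_npi_int cos_npi_int)
  then have "\<bar>sin (pi * y)\<bar> = \<bar>sin (pi * (y - round y))\<bar>" by auto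
  also have "\<dots> = \<bar>sin (pi * t)\<bar>"
    by (cases "0 \<le> y - round y") (simp_all only: t_def abs_of_nonneg abs_of_neg not_le
        mult_minus_right sin_minus abs_minus_cancel)
  also have "\<dots> \<ge> pi * t / 4" using sin_ge_quarter[of "pi * t"] t by simp
  finally have "pi * t / 4 \<le> \<bar>sin (pi * y)\<bar>" .
  moreover have "2 * t \<le> pi * t" using t pi_ge_two by (intro mult_right_mono) auto
  moreover have "norm (1 - cis (2 * pi * y)) = 2 * \<bar>sin (pi * y)\<bar>"
    using dist_exp_i_1[of "2 * pi * y"] by (simp add: cis_conv_exp norm_minus_commute)
  ultimately show ?thesis using t by linarith
qed

lemma norm_sum_cis_le:
  assumes "D > 0" "D \<le> norm (1 - cis \<theta>)"
  shows "norm (\<Sum>c<X. cis \<theta> ^ c) \<le> 2 / D"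
proof -
  have "cis \<theta> \<noteq> 1" using assms by auto
  then have "norm (\<Sum>c<X. cis \<theta> ^ c) = norm (cis \<theta> ^ X - 1) / norm (1 - cis \<theta>)"
    by (simp add: geometric_sum norm_divide norm_minus_commute)
  also have "\<dots> \<le> 2 / D"
  proof (rule frac_le)
    show "norm (cis \<theta> ^ X - 1) \<le> 2"
      using norm_triangle_ineq4[of "cis \<theta> ^ X" 1] by (simp add: norm_power)
  qed (use assms in auto)
  finally show ?thesis .
qed

text \<open>
  The Fejer kernel of degree \<open>H\<close> is at least \<open>H / 4\<close> on the arc of length \<open>1 / (3 H)\<close> around 0.
\<close>

lemma card_rotation_near_zero:
  fixes \<beta> s D :: real
  assumes H: "H > 0" and D: "D > 0"
    and sep: "\<And>h. 0 < h \<Longrightarrow> h < H \<Longrightarrow> D \<le> norm (1 - cis (2 * pi * (real h * \<beta>)))"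
  shows "real (card {c. c < X \<and> (\<exists>p::int. \<bar>real c * \<beta> + s - p\<bar> \<le> 1 / (6 * real H))})
           \<le> 4 * (real X / H + 2 / D)"
proof -
  define x where "x c = real c * \<beta> + s" for c :: nat
  \<comment> \<open>The squared norm of \<open>T c\<close> is \<open>H\<close> times the Fejer
    kernel at \<open>x c\<close>. Being nonnegative, it may be summed over all \<open>c < X\<close>
    instead of \<open>?S\<close>.\<close>
  define T where "T c = (\<Sum>j<H. cis (2 * pi * (real j * x c)))" for c
  let ?S = "{c. c < X \<and> (\<exists>p::int. \<bar>x c - p\<bar> \<le> 1 / (6 * real H))}"
  have low: "(real H / 2)\<^sup>2 \<le> (norm (T c))\<^sup>2" if c: "c \<in> ?S" for c
  proof -
    obtain p :: int where p: "\<bar>x c - p\<bar> \<le> 1 / (6 * real H)" using c by auto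
    have "1 / 2 \<le> Re (cis (2 * pi * (real j * x c)))" if "j < H" for j
    proof -
      define \<theta> where "\<theta> = 2 * pi * (real j * (x c - p))"
      have "real j * real_of_int p \<in> \<int>" by simp
      then have "cis (2 * pi * (real j * p)) = 1" by (rule cis_multiple_2pi)
      moreover have "2 * pi * (real j * x c) = \<theta> + 2 * pi * (real j * p)"
        by (simp add: \<theta>_def algebra_simps)
      ultimately have "cis (2 * pi * (real j * x c)) = cis \<theta>"
        by (simp add: cis_mult[symmetric])
      moreover have "\<bar>\<theta>\<bar> \<le> pi / 3"
      proof -
        have "\<bar>\<theta>\<bar> = 2 * pi * (real j * \<bar>x c - p\<bar>)" by (simp add: \<theta>_def abs_mult)
        also have "\<dots> \<le> 2 * pi * (real H * (1 / (6 * real H)))"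
          using p that by (intro mult_left_mono mult_mono) auto
        also have "\<dots> = pi / 3" using H by simp
        finally show ?thesis .
      qed
      then have "cos (pi / 3) \<le> cos \<bar>\<theta>\<bar>" by (intro cos_monotone_0_pi_le) auto
      ultimately show ?thesis by (simp add: cos_60)
    qed
    then have "(\<Sum>j<H. 1 / 2) \<le> (\<Sum>j<H. Re (cis (2 * pi * (real j * x c))))"
      by (intro sum_mono) auto
    then have "real H / 2 \<le> Re (T c)" by (simp add: T_def)
    also have "\<dots> \<le> norm (T c)" by (rule complex_Re_le_cmod)
    finally show ?thesis by (intro power_mono) auto
  qed
  \<comment> \<open>Off the diagonal the sum over \<open>c\<close> is geometric, and the shift
    \<open>s\<close> contributes only a phase. The term \<open>2 / D\<close> is added on the
    diagonal as well to keep one formula.\<close>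
  have corr: "norm (\<Sum>c<X. cis (2 * pi * (real j * x c)) * cnj (cis (2 * pi * (real k * x c))))
      \<le> (if j = k then real X else 0) + 2 / D" if "j < H" "k < H" for j k
  proof (cases "j = k")
    case True
    have "norm (\<Sum>c<X. cis (2 * pi * (real j * x c)) * cnj (cis (2 * pi * (real k * x c))))
        \<le> (\<Sum>c<X. 1)" by (rule order_trans[OF norm_sum sum_mono]) (simp add: norm_mult)
    then show ?thesis using True D by (simp add: add_increasing2)
  next
    case False
    define \<theta> where "\<theta> = 2 * pi * ((real j - real k) * \<beta>)"
    define \<eta> where "\<eta> = 2 * pi * ((real j - real k) * s)"
    have "cis (2 * pi * (real j * x c)) * cnj (cis (2 * pi * (real k * x c))) = cis \<eta> * cis \<theta> ^ c" for c
      by (simp add: cis_cnj cis_mult Complex.DeMoivre \<theta>_def \<eta>_def x_def algebra_simps)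
    then have "norm (\<Sum>c<X. cis (2 * pi * (real j * x c)) * cnj (cis (2 * pi * (real k * x c))))
        = norm (\<Sum>c<X. cis \<theta> ^ c)"
      by (simp add: sum_distrib_left[symmetric] norm_mult)
    also have "D \<le> norm (1 - cis \<theta>)"
    proof (cases "k < j")
      case True
      then have "\<theta> = 2 * pi * (real (j - k) * \<beta>)" by (simp add: \<theta>_def of_nat_diff)
      then show ?thesis using sep[of "j - k"] True that by simp
    next
      case False
      then have "- \<theta> = 2 * pi * (real (k - j) * \<beta>)" by (simp add: \<theta>_def of_nat_diff algebra_simps)
      then have "D \<le> norm (1 - cis (- \<theta>))" using sep[of "k - j"] False \<open>j \<noteq> k\<close> that by simp
      also have "1 - cis (- \<theta>) = cnj (1 - cis \<theta>)" by (simp add: cis_cnj)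
      finally show ?thesis by (simp only: complex_mod_cnj)
    qed
    then have "norm (\<Sum>c<X. cis \<theta> ^ c) \<le> 2 / D" by (rule norm_sum_cis_le[OF D])
    finally show ?thesis using False by simp
  qed
  have "complex_of_real (\<Sum>c<X. (norm (T c))\<^sup>2)
      = (\<Sum>c<X. \<Sum>j<H. \<Sum>k<H. cis (2 * pi * (real j * x c)) * cnj (cis (2 * pi * (real k * x c))))"
    by (simp only: of_real_sum complex_norm_square T_def cnj_sum sum_product)
  also have "\<dots> = (\<Sum>j<H. \<Sum>k<H. \<Sum>c<X. cis (2 * pi * (real j * x c)) * cnj (cis (2 * pi * (real k * x c))))"
    by (subst sum.swap) (rule sum.cong[OF refl], rule sum.swap)
  also have "norm \<dots> \<le> (\<Sum>j<H. \<Sum>k<H. (if j = k then real X else 0) + 2 / D)"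
    by (rule order_trans[OF norm_sum sum_mono], rule order_trans[OF norm_sum sum_mono])
       (use corr in auto)
  also have "\<dots> = real H * X + (real H)\<^sup>2 * (2 / D)"
    by (simp add: sum.distrib power2_eq_square distrib_left)
  finally have up: "(\<Sum>c<X. (norm (T c))\<^sup>2) \<le> real H * X + (real H)\<^sup>2 * (2 / D)"
    unfolding norm_of_real by linarith
  have "real (card ?S) * (real H / 2)\<^sup>2 = (\<Sum>c\<in>?S. (real H / 2)\<^sup>2)" by simp
  also have "\<dots> \<le> (\<Sum>c\<in>?S. (norm (T c))\<^sup>2)" using low by (intro sum_mono) auto
  also have "\<dots> \<le> (\<Sum>c<X. (norm (T c))\<^sup>2)" by (intro sum_mono2) auto
  also note up
  finally have "real (card ?S) * (real H)\<^sup>2 \<le> 4 * (real H * X + (real H)\<^sup>2 * (2 / D))"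
    by (simp add: power_divide)
  also have "\<dots> = 4 * (real X / H + 2 / D) * (real H)\<^sup>2"
    using H by (simp add: power2_eq_square distrib_left distrib_right)
  finally show ?thesis using H unfolding x_def by simp
qed

section \<open>Convergents\<close>

locale ostrowski_one_m =
  fixes m :: nat and \<alpha> :: real
  assumes m2: "m \<ge> 2"
    and \<alpha>_eq: "\<alpha> = (- real m + sqrt (real m ^ 2 + 4 * real m)) / 2"
begin

lemma m1: "m \<ge> 1"
  using m2 by simp

lemmas \<alpha>_quadratic = alpha_quadratic[OF \<alpha>_eq]

lemmas quot = cf_quot_periodic(2)[OF m1 \<alpha>_eq]

lemma quot_pos: "cf_quot \<alpha> (Suc i) \<ge> 1"
  using m1 by (simp add: quot del: cf_quot.simps)

lemma quot_le: "cf_quot \<alpha> (Suc i) \<le> int m"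
  using m1 by (simp add: quot del: cf_quot.simps)

lemma \<alpha>_bounds: "1 / 2 < \<alpha>" "\<alpha> < 1"
proof -
  note a = cf_rem_periodic(1,2)[OF m1 \<alpha>_eq]
  show "\<alpha> < 1" by (rule a)
  show "1 / 2 < \<alpha>"
  proof (rule ccontr)
    assume "\<not> 1 / 2 < \<alpha>"
    then have "\<alpha> * (\<alpha> + real m) \<le> 1 / 2 * (1 / 2 + real m)"
      using a by (intro mult_mono) auto
    then show False using \<alpha>_quadratic m2 by simp
  qed
qed

definition den :: "nat \<Rightarrow> nat" where
  "den i = nat (cf_denom \<alpha> i)"

lemma int_den: "int (den i) = cf_denom \<alpha> i"
  using cf_denom_pos[OF quot_pos, of i] by (simp add: den_def)

lemma den_pos: "den i > 0"
  using cf_denom_pos[OF quot_pos, of i] by (simp add: den_def)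

lemma den_0: "den 0 = 1" and den_1: "den (Suc 0) = 1"
  using cf_denom_periodic(1,2)[OF m1 \<alpha>_eq] by (simp_all add: den_def del: cf_denom.simps)

lemma den_Suc_Suc: "den (Suc (Suc i)) = (if even i then m else 1) * den (Suc i) + den i"
proof -
  have "int (den (Suc (Suc i))) = int ((if even i then m else 1) * den (Suc i) + den i)"
    using cf_denom_periodic(3)[OF m1 \<alpha>_eq, of i] by (simp add: int_den del: cf_denom.simps)
  then show ?thesis by (simp only: of_nat_eq_iff)
qed

lemma den_rec:
  assumes "i \<ge> 1"
  shows "den (Suc i) = nat (cf_quot \<alpha> (Suc i)) * den i + den (i - 1)"
  using assms den_Suc_Suc[of "i - 1"] by (cases i) (auto simp: quot simp del: cf_quot.simps)

lemma den_mono: "den i \<le> den (Suc i)"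
  by (cases i) (use m1 in \<open>auto simp: den_0 den_1 den_Suc_Suc add_increasing2\<close>)

text \<open>The recursion into an odd index has partial quotient 1.\<close>

lemma den_odd_le: "den (Suc (2 * j)) \<le> 2 * den (2 * j)"
proof (cases j)
  case (Suc i)
  then show ?thesis using den_mono[of "Suc (2 * i)"] by (simp add: den_Suc_Suc[of "Suc (2 * i)"])
qed (simp add: den_0 den_1)

lemma den_unbounded: "k \<le> den (2 * k)"
  using cf_denom_unbounded[OF quot_pos, of k] int_den[of "2 * k"] by linarith

text \<open>
  The determinant identity \<open>q\<^sub>i |q\<^sub>i\<^sub>+\<^sub>1 \<alpha> - p\<^sub>i\<^sub>+\<^sub>1| + q\<^sub>i\<^sub>+\<^sub>1 |q\<^sub>i \<alpha> - p\<^sub>i| = 1\<close> for consecutive convergents.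
\<close>

lemma den_determinant: "den (2 * j) * (1 - \<alpha>) ^ Suc j + den (Suc (2 * j)) * (\<alpha> * (1 - \<alpha>) ^ j) = 1"
proof (induction j)
  case 0
  then show ?case by (simp add: den_0 den_1)
next
  case (Suc j)
  let ?\<beta> = "1 - \<alpha>" and ?x = "real (den (2 * j))" and ?y = "real (den (Suc (2 * j)))"
  have 1: "real (den (2 * Suc j)) = m * ?y + ?x"
    by (simp add: den_Suc_Suc)
  have 2: "real (den (Suc (2 * Suc j))) = m * ?y + ?x + ?y"
    by (simp add: den_Suc_Suc)
  have key: "(m + \<alpha>) * ?\<beta> = \<alpha>" using \<alpha>_quadratic by (simp add: algebra_simps)
  have "real (den (2 * Suc j)) * ?\<beta> ^ Suc (Suc j) + real (den (Suc (2 * Suc j))) * (\<alpha> * ?\<beta> ^ Suc j)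
      = ?\<beta> ^ j * (?x * ?\<beta> + ?y * ((m + \<alpha>) * ?\<beta>))"
    unfolding 1 2 by (simp add: algebra_simps)
  also have "\<dots> = ?x * ?\<beta> ^ Suc j + ?y * (\<alpha> * ?\<beta> ^ j)"
    unfolding key by (simp add: algebra_simps)
  finally show ?case using Suc by simp
qed

text \<open>Both bounds come from the determinant identity: monotonicity of the denominators gives
  the lower one; dropping the first summand and using \<open>\<alpha> > 1 / 2\<close> gives the
  upper one.\<close>

lemma den_odd_bounds:
  "1 \<le> den (Suc (2 * j)) * (1 - \<alpha>) ^ j" "den (Suc (2 * j)) * (1 - \<alpha>) ^ j \<le> 2"
proof -
  define b where "b = (1 - \<alpha>) ^ j"
  have b: "b > 0" using \<alpha>_bounds by (simp add: b_def)
  let ?x = "real (den (2 * j))" and ?y = "real (den (Suc (2 * j)))"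
  have det: "?x * ((1 - \<alpha>) * b) + ?y * (\<alpha> * b) = 1"
    using den_determinant[of j] by (simp add: b_def)
  have "?x * ((1 - \<alpha>) * b) \<le> ?y * ((1 - \<alpha>) * b)"
    using den_mono[of "2 * j"] b \<alpha>_bounds by (intro mult_right_mono) auto
  then show "1 \<le> ?y * (1 - \<alpha>) ^ j"
    using det unfolding b_def[symmetric] by (simp add: algebra_simps)
  have "?y * (1 / 2 * b) \<le> ?y * (\<alpha> * b)"
    using b \<alpha>_bounds by (intro mult_left_mono mult_right_mono) auto
  moreover have "0 \<le> ?x * ((1 - \<alpha>) * b)" using b \<alpha>_bounds by simp
  ultimately show "?y * (1 - \<alpha>) ^ j \<le> 2"
    using det unfolding b_def[symmetric] by (simp add: algebra_simps)
qed

text \<open>This is the closed form of \<open>\<bar>den i * \<alpha> - p\<bar>\<close> with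
  \<open>p\<close> the numerator of the \<open>i\<close>-th convergent. Each period of the continued
  fraction contributes a factor \<open>1 - \<alpha>\<close>.\<close>

definition dist_conv :: "nat \<Rightarrow> real" where
  "dist_conv i = (if even i then \<alpha> * (1 - \<alpha>) ^ (i div 2) else (1 - \<alpha>) ^ Suc (i div 2))"

lemma dist_conv_nonneg: "dist_conv i \<ge> 0"
  using \<alpha>_bounds by (simp add: dist_conv_def)

text \<open>The signed distances obey the same recursion as the denominators; at even
  \<open>j\<close> this is the quadratic equation in the form
  \<open>\<alpha> - m * (1 - \<alpha>) = \<alpha> * (1 - \<alpha>)\<close>.\<close>

lemma den_times_\<alpha>: "\<exists>p::int. den i * \<alpha> = p + (-1) ^ i * dist_conv i"
proof (induction i rule: less_induct)
  case (less i)
  consider "i = 0" | "i = 1" | j where "i = Suc (Suc j)"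
    by (metis One_nat_def not0_implies_Suc)
  then show ?case
  proof cases
    case 1
    then show ?thesis by (intro exI[of _ 0]) (simp add: den_0 dist_conv_def)
  next
    case 2
    then show ?thesis by (intro exI[of _ 1]) (simp add: den_1 dist_conv_def)
  next
    case (3 j)
    obtain p r :: int where p: "den j * \<alpha> = p + (-1) ^ j * dist_conv j"
      and r: "den (Suc j) * \<alpha> = r + (-1) ^ Suc j * dist_conv (Suc j)"
      using less[of j] less[of "Suc j"] 3 by auto
    let ?c = "(if even j then m else 1)"
    have rec: "dist_conv j - ?c * dist_conv (Suc j) = dist_conv (Suc (Suc j))"
    proof (cases "even j")
      case True
      have "\<alpha> - m * (1 - \<alpha>) = \<alpha> * (1 - \<alpha>)" using \<alpha>_quadratic by (simp add: algebra_simps)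
      then have "(\<alpha> - m * (1 - \<alpha>)) * (1 - \<alpha>) ^ (j div 2) = \<alpha> * (1 - \<alpha>) * (1 - \<alpha>) ^ (j div 2)"
        by (simp only:)
      then show ?thesis using True by (simp add: dist_conv_def algebra_simps)
    next
      case False
      then show ?thesis by (simp add: dist_conv_def algebra_simps)
    qed
    have "den i * \<alpha> = ?c * (den (Suc j) * \<alpha>) + den j * \<alpha>"
      unfolding 3 by (simp add: den_Suc_Suc algebra_simps)
    also have "\<dots> = (int ?c * r + p) + (-1) ^ j * (dist_conv j - ?c * dist_conv (Suc j))"
      unfolding p r by (simp add: algebra_simps)
    finally show ?thesis unfolding rec 3 by (intro exI[of _ "int ?c * r + p"]) simp
  qed
qed

lemma sum_dist_conv_le: "(\<Sum>i\<in>{Suc (2 * j)..<K}. dist_conv i) \<le> 2 * (1 - \<alpha>) ^ j"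
proof -
  \<comment> \<open>\<open>tail i\<close> is the value of the infinite series of
    \<open>dist_conv\<close> from index \<open>i\<close> on, so the finite sums telescope.\<close>
  define tail where
    "tail i = (if even i then (1 - \<alpha>) ^ (i div 2) / \<alpha> else (1 - \<alpha>) ^ (i div 2) * (1 / \<alpha> - \<alpha>))" for i :: nat
  have \<alpha>: "0 < \<alpha>" "\<alpha> < 1" "1 / \<alpha> \<le> 2" "1 \<le> 1 / \<alpha>" using \<alpha>_bounds by (auto simp: field_simps)
  then have "\<alpha> \<le> 1 / \<alpha>" by linarith
  have step: "dist_conv i = tail i - tail (Suc i)" for i
  proof (cases "even i")
    case True
    then show ?thesis by (simp add: dist_conv_def tail_def algebra_simps)
  next
    case False
    have "1 - \<alpha> = (1 / \<alpha> - \<alpha>) - (1 - \<alpha>) / \<alpha>" using \<alpha> by (simp add: field_simps)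
    then have "(1 - \<alpha>) * (1 - \<alpha>) ^ (i div 2) = ((1 / \<alpha> - \<alpha>) - (1 - \<alpha>) / \<alpha>) * (1 - \<alpha>) ^ (i div 2)"
      by (simp only:)
    then show ?thesis using False by (simp add: dist_conv_def tail_def algebra_simps)
  qed
  have tail_nonneg: "tail i \<ge> 0" for i
    using \<alpha> \<open>\<alpha> \<le> 1 / \<alpha>\<close> by (auto simp: tail_def intro!: mult_nonneg_nonneg)
  have "(\<Sum>i\<in>{k..<K}. dist_conv i) \<le> tail k" for k
  proof (cases "k \<le> K")
    case True
    have "(\<Sum>i\<in>{k..<K}. dist_conv i) = tail k - tail K"
      unfolding step using sum_Suc_diff'[OF True, of "\<lambda>i. - tail i"] by simp
    then show ?thesis using tail_nonneg[of K] by simp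
  qed (simp add: tail_nonneg)
  also have "tail (Suc (2 * j)) \<le> (1 - \<alpha>) ^ j * 2"
    using \<alpha> by (simp add: tail_def mult_left_mono)
  finally show ?thesis by (simp add: mult.commute)
qed

text \<open>A norm argument in the quadratic field: the product of \<open>p - h * \<alpha>\<close>
  and its conjugate \<open>p + h * (\<alpha> + m)\<close> is a nonzero integer \<open>z\<close>, and
  the conjugate is at most \<open>(m + 3) * h\<close> when \<open>h * \<alpha>\<close> is within 1
  of \<open>p\<close>.\<close>

lemma \<alpha>_badly_approximable:
  fixes h :: nat and p :: int
  assumes h: "h \<ge> 1"
  shows "1 / ((m + 3) * real h) \<le> \<bar>h * \<alpha> - p\<bar>"
proof (cases "\<bar>h * \<alpha> - p\<bar> \<ge> 1")
  case True
  have "1 * 1 \<le> (m + 3) * real h" using h by (intro mult_mono) auto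
  then have "1 / ((m + 3) * real h) \<le> 1 / 1" using h by (intro divide_left_mono) auto
  then show ?thesis using True by simp
next
  case False
  define z where "z = p\<^sup>2 + int m * p * int h - int m * (int h)\<^sup>2"
  have nf: "real_of_int z = (p - h * \<alpha>) * (p + h * (\<alpha> + m))"
  proof -
    have "(p - h * \<alpha>) * (p + h * (\<alpha> + m)) = (real_of_int p)\<^sup>2 + m * p * h - (real h)\<^sup>2 * (\<alpha> * (\<alpha> + m))"
      by (simp add: algebra_simps power2_eq_square)
    then show ?thesis unfolding \<alpha>_quadratic z_def by (simp add: algebra_simps)
  qed
  have "z \<noteq> 0"
  proof
    assume "z = 0"
    then have sq: "(2 * p + int m * int h)\<^sup>2 = (int m ^ 2 + 4 * int m) * (int h)\<^sup>2"
      by (simp add: z_def power2_eq_square algebra_simps)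
    then have "(int h)\<^sup>2 dvd (2 * p + int m * int h)\<^sup>2" by simp
    then have "int h dvd 2 * p + int m * int h" by simp
    then obtain t where "2 * p + int m * int h = int h * t" by (elim dvdE)
    with sq h have "t\<^sup>2 = int m ^ 2 + 4 * int m" by (simp add: power_mult_distrib)
    then have t: "\<bar>t\<bar>\<^sup>2 = int m ^ 2 + 4 * int m" by simp
    \<comment> \<open>Irrationality of \<alpha>: the discriminant lies strictly between the
      consecutive squares of \<open>m + 1\<close> and \<open>m + 2\<close>.\<close>
    have "(int m + 1)\<^sup>2 < \<bar>t\<bar>\<^sup>2" unfolding t using m2 by (simp add: power2_eq_square algebra_simps)
    then have "int m + 1 < \<bar>t\<bar>" by (rule power_less_imp_less_base) simp
    moreover have "\<bar>t\<bar>\<^sup>2 < (int m + 2)\<^sup>2" unfolding t by (simp add: power2_eq_square algebra_simps)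
    then have "\<bar>t\<bar> < int m + 2" by (rule power_less_imp_less_base) simp
    ultimately show False by simp
  qed
  then have "1 \<le> \<bar>real_of_int z\<bar>" by linarith
  also have "\<dots> = \<bar>h * \<alpha> - p\<bar> * \<bar>p + h * (\<alpha> + m)\<bar>"
    unfolding nf abs_mult by (simp add: abs_minus_commute)
  also have "\<dots> \<le> \<bar>h * \<alpha> - p\<bar> * ((m + 3) * real h)"
  proof (rule mult_left_mono)
    have ha: "0 \<le> h * \<alpha>" "h * \<alpha> \<le> h" "0 \<le> real h * m" "1 \<le> real h"
      using \<alpha>_bounds h by (auto simp: mult_left_le)
    have "\<bar>p + h * (\<alpha> + m)\<bar> \<le> 1 + 2 * (h * \<alpha>) + real h * m"
      using False ha by (simp add: algebra_simps abs_le_iff)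
    also have "\<dots> \<le> real h + 2 * real h + real h * m" using ha by linarith
    finally show "\<bar>p + h * (\<alpha> + m)\<bar> \<le> (m + 3) * real h" by (simp add: algebra_simps)
  qed simp
  finally show ?thesis using h by (simp add: divide_le_eq mult.commute)
qed

text \<open>
  The members of a residue class modulo \<open>M\<close> follow the rotation by \<open>M \<alpha>\<close>, which is badly
  approximable with a constant that loses only a factor \<open>M\<close>.
\<close>

lemma card_near_zero_progression:
  assumes H: "H > 0" and M: "M > 0"
  shows "real (card {c. c < X \<and> (\<exists>p::int. \<bar>real (M * c + r) * \<alpha> - p\<bar> \<le> 1 / (6 * real H))})
           \<le> 4 * (real X / H + 2 * (m + 3) * H * M)"
proof -
  define D where "D = 1 / ((m + 3) * real H * M)"
  have D: "D > 0" using H M by (simp add: D_def)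
  have sep: "D \<le> norm (1 - cis (2 * pi * (real h * (M * \<alpha>))))" if h: "0 < h" "h < H" for h
  proof (rule norm_one_minus_cis_ge)
    fix p :: int
    have "D \<le> 1 / ((m + 3) * real (h * M))"
      unfolding D_def using h M by (intro frac_le) (auto intro!: mult_mono)
    also have "\<dots> \<le> \<bar>real (h * M) * \<alpha> - p\<bar>"
      using h M by (intro \<alpha>_badly_approximable) (simp add: Suc_le_eq)
    finally show "D \<le> \<bar>real h * (M * \<alpha>) - p\<bar>" by (simp add: mult.assoc)
  qed
  have "real (card {c. c < X \<and> (\<exists>p::int. \<bar>real c * (M * \<alpha>) + r * \<alpha> - p\<bar> \<le> 1 / (6 * real H))})
           \<le> 4 * (real X / H + 2 / D)"
    by (rule card_rotation_near_zero[OF H D sep])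
  then show ?thesis by (simp add: D_def algebra_simps)
qed

end

section \<open>Ostrowski blocks\<close>

context ostrowski_one_m
begin

section \<open>Ostrowski digits and the sum of digits\<close>

abbreviation "dig \<equiv> ostrowski_digit \<alpha>"

definition osum :: "nat \<Rightarrow> nat" where
  "osum n = nat (ostrowski_sum \<alpha> n)"

text \<open>The first partial quotient is 1, which forces the lowest digit to vanish.\<close>

lemma adm_iff:
  "adm \<alpha> b \<longleftrightarrow> b 0 = 0 \<and> (\<forall>i\<ge>1. 0 \<le> b i \<and> b i \<le> cf_quot \<alpha> (Suc i)) \<and>
     (\<forall>i\<ge>1. b i = cf_quot \<alpha> (Suc i) \<longrightarrow> b (i - 1) = 0)"
  using quot[of 0] by (auto simp: adm_def[OF quot_pos] simp del: cf_quot.simps)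

text \<open>By uniqueness of the expansion, exhibiting one admissible sequence with the right value
  determines the digits; the digit computations below rest on this.\<close>

lemma rep_of_adm:
  assumes b: "adm \<alpha> b" "\<forall>i\<ge>K. b i = 0" and n: "int n = (\<Sum>i<K. b i * int (den i))"
  shows "dig n = b" "ostrowski_sum \<alpha> n = (\<Sum>i<K. b i)"
proof -
  have sub: "{i. b i \<noteq> 0} \<subseteq> {..<K}" using b(2) by (auto simp: not_less[symmetric])
  then have fin: "finite {i. b i \<noteq> 0}" by (rule finite_subset) auto
  have "int n = (\<Sum>i | b i \<noteq> 0. b i * cf_denom \<alpha> i)"
    unfolding ostrowski_sum_eq[OF quot_pos b(2)] using n by (simp add: int_den)
  then have "ostrowski_rep \<alpha> n b"
    using b(1) fin unfolding ostrowski_rep_def adm_def[OF quot_pos] by blast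
  then show d: "dig n = b"
    unfolding ostrowski_digit_def using ostrowski_ex1_periodic[OF m1 \<alpha>_eq] by (rule the1_equality[rotated])
  show "ostrowski_sum \<alpha> n = (\<Sum>i<K. b i)"
    unfolding ostrowski_sum_def d using sub by (intro sum.mono_neutral_left) auto
qed

lemma dig_props:
  assumes "n < den K"
  shows "adm \<alpha> (dig n)" "\<And>i. i \<ge> K \<Longrightarrow> dig n i = 0" "int n = (\<Sum>i<K. dig n i * int (den i))"
    "ostrowski_sum \<alpha> n = (\<Sum>i<K. dig n i)"
proof -
  have "int n < cf_denom \<alpha> K" using assms int_den[of K] by linarith
  then obtain b where b: "adm \<alpha> b" "\<forall>i\<ge>K. b i = 0" "int n = (\<Sum>i<K. b i * int (den i))"
    using adm_exists[OF quot_pos, of "int n" K] by (auto simp: int_den)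
  note r = rep_of_adm[OF b]
  show "adm \<alpha> (dig n)" "\<And>i. i \<ge> K \<Longrightarrow> dig n i = 0" "int n = (\<Sum>i<K. dig n i * int (den i))"
    "ostrowski_sum \<alpha> n = (\<Sum>i<K. dig n i)"
    using b r by auto
qed

lemma den_large: "n + k < den (2 * (n + k + 1))"
  using den_unbounded[of "n + k + 1"] by linarith

lemma adm_dig: "adm \<alpha> (dig n)"
  using dig_props(1)[OF den_large[of n 0, simplified]] .

lemma dig_nonneg: "dig n i \<ge> 0"
  using adm_dig[of n] unfolding adm_iff by (cases i) auto

lemma dig_le: "dig n i \<le> int m"
proof (cases "i \<ge> 1")
  case True
  then show ?thesis using adm_dig[of n] quot_le[of i] unfolding adm_iff by fastforce
next
  case False
  then have "i = 0" by simp
  then show ?thesis using adm_dig[of n] unfolding adm_iff by simp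
qed

lemma int_osum: "int (osum n) = ostrowski_sum \<alpha> n"
  unfolding osum_def ostrowski_sum_def using dig_nonneg by (simp add: sum_nonneg)

text \<open>
  The starting points of the blocks of level \<open>k\<close>: adding \<open>u\<close> below the block length only
  affects the digits below \<open>k\<close>.
\<close>

definition block_starts :: "nat \<Rightarrow> nat set" where
  "block_starts k = {v. \<forall>i<k. dig v i = 0}"

text \<open>A maximal digit at \<open>k\<close> forces the digit at \<open>k - 1\<close> to be 0,
  which leaves room only for numbers below \<open>den (k - 1)\<close>.\<close>

definition block_len :: "nat \<Rightarrow> nat \<Rightarrow> nat" where
  "block_len k v = (if dig v k = cf_quot \<alpha> (Suc k) then den (k - 1) else den k)"

lemma block_len_bounds: "den (k - 1) \<le> block_len k v" "block_len k v \<le> den k"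
  using den_mono[of "k - 1"] by (cases k; auto simp: block_len_def)+

text \<open>The two digit sequences have disjoint supports, so admissibility of their sum could fail
  only at the seam: a maximal digit of \<open>v\<close> at \<open>k\<close> next to a nonzero digit
  of \<open>u\<close> at \<open>k - 1\<close>. The block length excludes this.\<close>

lemma dig_add:
  assumes k: "k \<ge> 1" and v: "v \<in> block_starts k" and u: "u < block_len k v"
  shows "\<And>i. i \<ge> k \<Longrightarrow> dig u i = 0" "dig (v + u) = (\<lambda>i. dig v i + dig u i)"
    "osum (v + u) = osum v + osum u"
proof -
  define K where "K = 2 * (v + u + k + 1)"
  have K: "v < den K" "u < den K" "k \<le> K"
    using den_large[of "v + u" k] by (auto simp: K_def)
  note V = dig_props[OF K(1)] and U = dig_props[OF K(2)]
  have low: "dig v i = 0" if "i < k" for i using v that by (simp add: block_starts_def)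
  have "u < den k" using u block_len_bounds(2)[of k v] by linarith
  from dig_props(2)[OF this] show high: "\<And>i. i \<ge> k \<Longrightarrow> dig u i = 0" .
  have carry: "dig u (k - 1) = 0" if "dig v k = cf_quot \<alpha> (Suc k)"
    using dig_props(2)[of u "k - 1" "k - 1"] u that by (simp add: block_len_def del: cf_quot.simps)
  have adm: "adm \<alpha> (\<lambda>i. dig v i + dig u i)"
    unfolding adm_iff
  proof (intro conjI allI impI)
    show "dig v 0 + dig u 0 = 0" using V(1) U(1) unfolding adm_iff by simp
    fix i :: nat assume i: "1 \<le> i"
    show "0 \<le> dig v i + dig u i" using dig_nonneg by (simp add: add_nonneg_nonneg)
    show "dig v i + dig u i \<le> cf_quot \<alpha> (Suc i)"
      using low[of i] high[of i] V(1) U(1) i unfolding adm_iff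
      by (cases "i < k") (auto simp del: cf_quot.simps)
    assume eq: "dig v i + dig u i = cf_quot \<alpha> (Suc i)"
    consider "i < k" | "i = k" | "i > k" by linarith
    then show "dig v (i - 1) + dig u (i - 1) = 0"
    proof cases
      case 1
      then have "dig u i = cf_quot \<alpha> (Suc i)" using eq low by (simp del: cf_quot.simps)
      then show ?thesis using U(1) i low[of "i - 1"] 1 unfolding adm_iff by (simp del: cf_quot.simps)
    next
      case 2
      then show ?thesis using eq high[of k] carry low[of "k - 1"] k by (simp del: cf_quot.simps)
    next
      case 3
      then have "dig v i = cf_quot \<alpha> (Suc i)" using eq high[of i] by (simp del: cf_quot.simps)
      then show ?thesis using V(1) i high[of "i - 1"] 3 unfolding adm_iff by (simp del: cf_quot.simps)
    qed
  qed
  have z: "\<forall>i\<ge>K. dig v i + dig u i = 0" using V(2) U(2) by simp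
  have n: "int (v + u) = (\<Sum>i<K. (dig v i + dig u i) * int (den i))"
    using V(3) U(3) by (simp add: distrib_right sum.distrib)
  show "dig (v + u) = (\<lambda>i. dig v i + dig u i)" by (rule rep_of_adm(1)[OF adm z n])
  have "int (osum (v + u)) = int (osum v + osum u)"
    using rep_of_adm(2)[OF adm z n] V(4) U(4) by (simp add: int_osum sum.distrib)
  then show "osum (v + u) = osum v + osum u" by (simp only: of_nat_eq_iff)
qed

text \<open>\<open>v\<close> collects the digits of \<open>n\<close> from position \<open>k\<close>
  on and \<open>u\<close> those below.\<close>

lemma block_decomposition:
  assumes k: "k \<ge> 1"
  obtains v u where "v \<in> block_starts k" "u < block_len k v" "n = v + u"
proof -
  define K where "K = 2 * (n + k + 1)"
  have K: "n < den K" "k \<le> K" using den_large[of n k] by (auto simp: K_def)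
  define b where "b = dig n"
  note N = dig_props[OF K(1), folded b_def]
  define S where "S J = (\<Sum>i\<in>J. b i * int (den i))" for J
  have S0: "S J \<ge> 0" for J
    unfolding S_def b_def using dig_nonneg by (intro sum_nonneg mult_nonneg_nonneg) auto
  have small: "S {..<l} < int (den l)" for l
    using adm_sum_less[OF quot_pos N(1), of l] by (simp add: S_def int_den)
  have split: "int n = S {..<k} + S {k..<K}"
    unfolding N(3) S_def lessThan_atLeast0 using K(2) by (simp add: sum.atLeastLessThan_concat)
  define v u where "v = nat (S {k..<K})" and "u = nat (S {..<k})"
  have int_v: "int v = S {k..<K}" and int_u: "int u = S {..<k}" using S0 by (simp_all add: v_def u_def)
  define b' where "b' i = (if i < k then 0 else b i)" for i
  have qne: "cf_quot \<alpha> (Suc i) \<noteq> 0" for i using quot_pos[of i] by linarith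
  have "adm \<alpha> b'"
    using N(1) k qne qne[symmetric] quot_pos unfolding adm_iff b'_def
    by (auto intro: order_trans[OF zero_le_one] simp del: cf_quot.simps)
  moreover have "\<forall>i\<ge>K. b' i = 0" using N(2) K(2) by (simp add: b'_def)
  moreover have "int v = (\<Sum>i<K. b' i * int (den i))"
    unfolding int_v S_def
    by (rule sum.mono_neutral_cong_left) (auto simp: b'_def)
  ultimately have dv: "dig v = b'" by (rule rep_of_adm(1))
  show thesis
  proof (rule that)
    show "v \<in> block_starts k" by (simp add: block_starts_def dv b'_def)
    show "n = v + u" using split int_v int_u by linarith
    show "u < block_len k v"
    proof (cases "b k = cf_quot \<alpha> (Suc k)")
      case True
      then have "b (k - 1) = 0" using N(1) k unfolding adm_iff by blast
      then have "S {..<k} = S {..<k - 1}"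
        using k unfolding S_def by (cases k) auto
      then have "int u < int (den (k - 1))" using small[of "k - 1"] int_u by simp
      then show ?thesis using True by (simp add: block_len_def dv b'_def del: cf_quot.simps)
    next
      case False
      then show ?thesis using small[of k] int_u by (simp add: block_len_def dv b'_def del: cf_quot.simps)
    qed
  qed
qed

text \<open>From position \<open>k\<close> on, the digits of a block start are those of the sum, and
  below \<open>k\<close> they are 0.\<close>

lemma block_start_unique:
  assumes k: "k \<ge> 1" and v: "v \<in> block_starts k" "u < block_len k v"
    and v': "v' \<in> block_starts k" "u' < block_len k v'" and eq: "v + u = v' + u'"
  shows "v = v'"
proof -
  have "dig v i = dig v' i" for i
  proof (cases "i < k")
    case True
    then show ?thesis using v(1) v'(1) by (simp add: block_starts_def)
  next
    case False
    then have "dig u i = 0" "dig u' i = 0"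
      using dig_add(1)[OF k v] dig_add(1)[OF k v'] by auto
    then show ?thesis
      using fun_cong[OF dig_add(2)[OF k v], of i] fun_cong[OF dig_add(2)[OF k v'], of i] eq by simp
  qed
  moreover define K where "K = 2 * (v + v' + 1)"
  moreover have "v < den K" "v' < den K" using den_large[of v v'] by (auto simp: K_def)
  ultimately have "int v = int v'" using dig_props(3) by simp
  then show ?thesis by simp
qed

text \<open>The blocks tile the natural numbers, and \<open>A\<close> holds the starts of those
  contained in \<open>{..<N}\<close>. What remains below \<open>N\<close> lies in a block sticking
  out beyond \<open>N\<close>, hence within \<open>den k\<close> of \<open>N\<close>. On each block
  the factor \<open>\<omega> ^ osum v\<close> pulls out with norm 1.\<close>

lemma block_sum_bound:
  fixes F :: "nat \<Rightarrow> complex"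
  assumes k: "k \<ge> 1" and F: "\<And>n. norm (F n) \<le> 1" and \<omega>: "norm \<omega> = 1"
  obtains A where "finite A" "A \<subseteq> block_starts k" "\<And>v. v \<in> A \<Longrightarrow> v < N"
    "card A * den (k - 1) \<le> N"
    "norm (\<Sum>n<N. F n * \<omega> ^ osum n)
       \<le> den k + (\<Sum>v\<in>A. norm (\<Sum>u<block_len k v. F (v + u) * \<omega> ^ osum u))"
proof -
  define A where "A = {v \<in> block_starts k. v + block_len k v \<le> N}"
  define I where "I v = {v..<v + block_len k v}" for v
  define h where "h n = F n * \<omega> ^ osum n" for n
  have h1: "norm (h n) \<le> 1" for n using F \<omega> by (simp add: h_def norm_mult norm_power)
  have len0: "block_len k v > 0" for v
    using block_len_bounds(1)[where k=k] den_pos[of "k - 1"] by (meson less_le_trans)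
  have A: "A \<subseteq> block_starts k" by (auto simp: A_def)
  have AN: "v < N" if "v \<in> A" for v using that len0[of v] by (simp add: A_def)
  then have fin: "finite A" by (meson finite_lessThan finite_subset lessThan_iff subsetI)
  have disj: "I v \<inter> I w = {}" if "v \<in> A" "w \<in> A" "v \<noteq> w" for v w
  proof (rule ccontr)
    assume "I v \<inter> I w \<noteq> {}"
    then obtain n where "n \<in> I v" "n \<in> I w" by auto
    then have n: "n - v < block_len k v" "n - w < block_len k w" "v + (n - v) = w + (n - w)"
      by (auto simp: I_def)
    have "v = w"
      by (rule block_start_unique[OF k subsetD[OF A that(1)] n(1) subsetD[OF A that(2)] n(2,3)])
    then show False using that by simp
  qed
  define U where "U = (\<Union>v\<in>A. I v)"
  have U: "U \<subseteq> {..<N}" by (auto simp: U_def I_def A_def)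
  have "card A * den (k - 1) = (\<Sum>v\<in>A. den (k - 1))" by simp
  also have "\<dots> \<le> (\<Sum>v\<in>A. card (I v))"
    using block_len_bounds(1) by (intro sum_mono) (simp add: I_def)
  also have "\<dots> = card U"
    unfolding U_def using fin disj by (intro card_UN_disjoint[symmetric]) (auto simp: I_def)
  also have "\<dots> \<le> card {..<N}" using U by (intro card_mono) auto
  finally have card: "card A * den (k - 1) \<le> N" by simp
  have "{..<N} - U \<subseteq> {N - den k..<N}"
  proof
    fix n assume n: "n \<in> {..<N} - U"
    obtain v u where vu: "v \<in> block_starts k" "u < block_len k v" "n = v + u"
      using block_decomposition[OF k] by metis
    then have "n \<in> I v" by (simp add: I_def)
    then have "v \<notin> A" using n by (auto simp: U_def)
    then have "N < v + block_len k v" using vu(1) by (simp add: A_def)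
    then show "n \<in> {N - den k..<N}" using n vu block_len_bounds(2)[of k v] by auto
  qed
  then have "card ({..<N} - U) \<le> card {N - den k..<N}" by (intro card_mono) auto
  then have rest: "card ({..<N} - U) \<le> den k" by simp
  have "norm (\<Sum>n<N. h n) = norm ((\<Sum>n\<in>{..<N} - U. h n) + (\<Sum>n\<in>U. h n))"
    using U by (simp add: sum.subset_diff)
  also have "\<dots> \<le> norm (\<Sum>n\<in>{..<N} - U. h n) + norm (\<Sum>n\<in>U. h n)" by (rule norm_triangle_ineq)
  also have "norm (\<Sum>n\<in>{..<N} - U. h n) \<le> (\<Sum>n\<in>{..<N} - U. 1)"
    by (rule order_trans[OF norm_sum sum_mono]) (rule h1)
  also have "\<dots> \<le> real (den k)" using rest by simp
  also have "norm (\<Sum>n\<in>U. h n) = norm (\<Sum>v\<in>A. \<Sum>n\<in>I v. h n)"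
    unfolding U_def using fin disj by (subst sum.UNION_disjoint) (auto simp: I_def)
  also have "\<dots> \<le> (\<Sum>v\<in>A. norm (\<Sum>n\<in>I v. h n))" by (rule norm_sum)
  also have "\<dots> = (\<Sum>v\<in>A. norm (\<Sum>u<block_len k v. F (v + u) * \<omega> ^ osum u))"
  proof (rule sum.cong[OF refl])
    fix v assume "v \<in> A"
    then have v: "v \<in> block_starts k" using A by auto
    have "(\<Sum>n\<in>I v. h n) = (\<Sum>u<block_len k v. h (v + u))"
      unfolding I_def using sum.shift_bounds_nat_ivl[of h 0 v "block_len k v"]
      by (simp add: lessThan_atLeast0 add.commute)
    also have "\<dots> = \<omega> ^ osum v * (\<Sum>u<block_len k v. F (v + u) * \<omega> ^ osum u)"
      unfolding sum_distrib_left
      by (intro sum.cong refl) (simp add: h_def dig_add(3)[OF k v] power_add)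
    finally show "norm (\<Sum>n\<in>I v. h n) = norm (\<Sum>u<block_len k v. F (v + u) * \<omega> ^ osum u)"
      using \<omega> by (simp add: norm_mult norm_power)
  qed
  finally show thesis using that[OF fin A AN card] unfolding h_def by simp
qed

text \<open>Expand \<open>v * \<alpha>\<close> along the digits of \<open>v\<close>: each
  \<open>den i * \<alpha>\<close> is within \<open>dist_conv i\<close> of an integer, only indices
  above \<open>2 * j\<close> occur, and digits are at most \<open>m\<close>.\<close>

lemma block_starts_near_zero:
  assumes "v \<in> block_starts (Suc (2 * j))"
  shows "\<exists>p::int. \<bar>v * \<alpha> - p\<bar> \<le> 2 * m * (1 - \<alpha>) ^ j"
proof -
  define K where "K = 2 * (v + 1)"
  have K: "v < den K" using den_large[of v 0] by (simp add: K_def)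
  obtain p :: "nat \<Rightarrow> int" where p: "\<And>i. den i * \<alpha> = p i + (-1) ^ i * dist_conv i"
    using den_times_\<alpha> by metis
  have "real v = (\<Sum>i<K. dig v i * den i)"
    using arg_cong[OF dig_props(3)[OF K], of real_of_int] by simp
  then have "v * \<alpha> = (\<Sum>i<K. dig v i * (den i * \<alpha>))"
    by (simp add: sum_distrib_right mult.assoc)
  also have "\<dots> = real_of_int (\<Sum>i<K. dig v i * p i) + (\<Sum>i<K. dig v i * ((-1) ^ i * dist_conv i))"
    unfolding p by (simp add: distrib_left sum.distrib)
  finally have "\<bar>v * \<alpha> - real_of_int (\<Sum>i<K. dig v i * p i)\<bar>
      = \<bar>\<Sum>i<K. dig v i * ((-1) ^ i * dist_conv i)\<bar>" by simp
  also have "\<dots> \<le> (\<Sum>i<K. \<bar>dig v i * ((-1) ^ i * dist_conv i)\<bar>)" by (rule sum_abs)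
  also have "\<dots> = (\<Sum>i<K. dig v i * dist_conv i)"
    using dig_nonneg dist_conv_nonneg by (simp add: abs_mult power_abs)
  also have "\<dots> = (\<Sum>i\<in>{Suc (2 * j)..<K}. dig v i * dist_conv i)"
    using assms by (intro sum.mono_neutral_right) (auto simp: block_starts_def)
  also have "\<dots> \<le> (\<Sum>i\<in>{Suc (2 * j)..<K}. m * dist_conv i)"
    using dig_le[of v] dist_conv_nonneg by (intro sum_mono mult_right_mono) (auto simp: of_int_le_iff[symmetric, where 'a=real] simp del: of_int_le_iff)
  also have "\<dots> \<le> m * (2 * (1 - \<alpha>) ^ j)"
    unfolding sum_distrib_left[symmetric] by (intro mult_left_mono sum_dist_conv_le) auto
  also have "\<dots> = 2 * m * (1 - \<alpha>) ^ j" by simp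
  finally show ?thesis by (rule exI)
qed

text \<open>\<open>den i * b\<close> has the single digit \<open>b\<close> at position
  \<open>i\<close>, so it is a block start of level \<open>i\<close> and \<open>dig_add\<close>
  applies.\<close>

lemma osum_leading:
  assumes i: "i \<ge> 1" and b: "int b \<le> cf_quot \<alpha> (Suc i)"
    and u: "u < (if int b = cf_quot \<alpha> (Suc i) then den (i - 1) else den i)"
  shows "osum (den i * b + u) = b + osum u"
proof -
  define d where "d j = (if j = i then int b else 0)" for j
  have qne: "0 \<noteq> cf_quot \<alpha> (Suc j)" for j using quot_pos[of j] by linarith
  have adm: "adm \<alpha> d"
    unfolding adm_iff d_def using i b qne quot_pos
    by (auto intro: order_trans[OF zero_le_one] simp del: cf_quot.simps)
  have z: "\<forall>j\<ge>Suc i. d j = 0" by (simp add: d_def)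
  have n: "int (den i * b) = (\<Sum>j<Suc i. d j * int (den j))" by (simp add: d_def)
  have dig: "dig (den i * b) = d" by (rule rep_of_adm(1)[OF adm z n])
  have "int (osum (den i * b)) = int b"
    using rep_of_adm(2)[OF adm z n] by (simp add: int_osum d_def)
  then have "osum (den i * b) = b" by simp
  moreover have "den i * b \<in> block_starts i" by (simp add: block_starts_def dig d_def)
  moreover have "u < block_len i (den i * b)" using u by (simp add: block_len_def dig d_def del: cf_quot.simps)
  ultimately show ?thesis using dig_add(3)[OF i] by simp
qed

section \<open>Exponential sums over the integers below a denominator\<close>

definition osum_exp_sum :: "complex \<Rightarrow> nat \<Rightarrow> complex" where
  "osum_exp_sum \<omega> i = (\<Sum>n<den i. \<omega> ^ osum n)"

text \<open>The integers below \<open>den (Suc i)\<close> are sorted by their digit at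
  \<open>i\<close>: a full range for each digit below \<open>c\<close>, and a range of length
  \<open>den (i - 1)\<close> for the maximal digit \<open>c\<close>.\<close>

lemma osum_exp_sum_rec:
  assumes i: "i \<ge> 1"
  defines "c \<equiv> nat (cf_quot \<alpha> (Suc i))"
  shows "osum_exp_sum \<omega> (Suc i)
    = (\<Sum>b<c. \<omega> ^ b) * osum_exp_sum \<omega> i + \<omega> ^ c * osum_exp_sum \<omega> (i - 1)"
proof -
  have c: "int c = cf_quot \<alpha> (Suc i)" using quot_pos[of i] by (simp add: c_def del: cf_quot.simps)
  have "den (Suc i) = den i * c + den (i - 1)"
    using den_rec[OF i] by (simp add: c_def mult.commute)
  then have "osum_exp_sum \<omega> (Suc i)
      = (\<Sum>n<den i * c. \<omega> ^ osum n) + (\<Sum>n=den i * c..<den i * c + den (i - 1). \<omega> ^ osum n)"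
    by (simp add: osum_exp_sum_def lessThan_atLeast0 sum.atLeastLessThan_concat)
  also have "(\<Sum>n=den i * c..<den i * c + den (i - 1). \<omega> ^ osum n)
      = (\<Sum>u<den (i - 1). \<omega> ^ osum (den i * c + u))"
    using sum.shift_bounds_nat_ivl[of "\<lambda>n. \<omega> ^ osum n" 0 "den i * c" "den (i - 1)"]
    by (simp add: lessThan_atLeast0 add.commute)
  also have "\<dots> = (\<Sum>u<den (i - 1). \<omega> ^ c * \<omega> ^ osum u)"
    using c by (intro sum.cong refl) (simp add: osum_leading[OF i] power_add del: cf_quot.simps)
  also have "\<dots> = \<omega> ^ c * osum_exp_sum \<omega> (i - 1)"
    by (simp add: osum_exp_sum_def sum_distrib_left)
  also have "(\<Sum>n<den i * c. \<omega> ^ osum n) = (\<Sum>b<c. \<Sum>u<den i. \<omega> ^ osum (den i * b + u))"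
    by (rule sum_lessThan_mult)
  also have "\<dots> = (\<Sum>b<c. \<Sum>u<den i. \<omega> ^ b * \<omega> ^ osum u)"
  proof (intro sum.cong refl)
    fix b u assume "b \<in> {..<c}" "u \<in> {..<den i}"
    then show "\<omega> ^ osum (den i * b + u) = \<omega> ^ b * \<omega> ^ osum u"
      using c by (subst osum_leading[OF i]) (auto simp: power_add simp del: cf_quot.simps)
  qed
  also have "\<dots> = (\<Sum>b<c. \<omega> ^ b) * osum_exp_sum \<omega> i"
    by (simp add: osum_exp_sum_def sum_product)
  finally show ?thesis .
qed

text \<open>The saving arises in the steps with partial quotient \<open>m\<close>, where the
  geometric sum has norm \<open>s < m\<close>; the steps with quotient 1 pass it on. The induction
  covers one period at a time.\<close>

lemma osum_exp_sum_saving: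
  assumes \<omega>: "norm \<omega> = 1" "\<omega> \<noteq> 1"
  obtains \<nu> :: real where "0 < \<nu>" "\<nu> < 1"
    "\<And>j. norm (osum_exp_sum \<omega> (2 * j)) \<le> \<nu> ^ j * den (2 * j)"
    "\<And>j. norm (osum_exp_sum \<omega> (Suc (2 * j))) \<le> \<nu> ^ j * den (Suc (2 * j))"
proof -
  define T where "T = osum_exp_sum \<omega>"
  define s where "s = norm (\<Sum>b<m. \<omega> ^ b)"
  have s: "0 \<le> s" "s < m" using norm_geometric_sum_less[OF \<omega> m2] by (auto simp: s_def)
  \<comment> \<open>The worst ratio of \<open>s * y + x\<close> to \<open>m * y + x\<close> under
    \<open>x \<le> y\<close>, reached at \<open>x = y\<close>.\<close>
  define \<nu>1 where "\<nu>1 = (s + 1) / (m + 1)"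
  have \<nu>1: "0 < \<nu>1" "\<nu>1 < 1" using s by (auto simp: \<nu>1_def)
  \<comment> \<open>In \<open>y' = x' + y\<close> only \<open>x'\<close> carries the new saving;
    since \<open>y\<close> is at most \<open>x'\<close>, the average of \<open>\<nu>1\<close> and 1
    is enough.\<close>
  define \<nu> where "\<nu> = (1 + \<nu>1) / 2"
  have \<nu>: "0 < \<nu>" "\<nu> < 1" "\<nu>1 \<le> \<nu>" using \<nu>1 by (auto simp: \<nu>_def)
  have odd: "T (Suc (Suc (2 * j))) = (\<Sum>b<m. \<omega> ^ b) * T (Suc (2 * j)) + \<omega> ^ m * T (2 * j)" for j
    using osum_exp_sum_rec[of "Suc (2 * j)" \<omega>] by (simp add: T_def quot del: cf_quot.simps)
  have even: "T (Suc (Suc (Suc (2 * j)))) = T (Suc (Suc (2 * j))) + \<omega> * T (Suc (2 * j))" for j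
    using osum_exp_sum_rec[of "Suc (Suc (2 * j))" \<omega>] by (simp add: T_def quot del: cf_quot.simps)
  have main: "norm (T (2 * j)) \<le> \<nu> ^ j * den (2 * j) \<and> norm (T (Suc (2 * j))) \<le> \<nu> ^ j * den (Suc (2 * j))" for j
  proof (induction j)
    case 0
    have "adm \<alpha> (\<lambda>_. 0)"
      unfolding adm_iff using quot_pos by (auto intro: order_trans[OF zero_le_one] simp del: cf_quot.simps)
    then have "osum 0 = 0" using rep_of_adm(2)[of "\<lambda>_. 0" 0 0] by (simp add: osum_def)
    then show ?case by (simp add: T_def osum_exp_sum_def den_0 den_1)
  next
    case (Suc j)
    let ?x = "real (den (2 * j))" and ?y = "real (den (Suc (2 * j)))"
    let ?x' = "real (den (Suc (Suc (2 * j))))" and ?y' = "real (den (Suc (Suc (Suc (2 * j)))))"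
    have x': "?x' = m * ?y + ?x" and y': "?y' = ?x' + ?y" by (simp_all add: den_Suc_Suc)
    have xy: "?x \<le> ?y" "?y \<le> ?x'" using den_mono by simp_all
    have \<nu>j: "\<nu> ^ j > 0" using \<nu> by simp
    have "norm (T (Suc (Suc (2 * j)))) \<le> s * norm (T (Suc (2 * j))) + norm (T (2 * j))"
      unfolding odd s_def using norm_triangle_ineq[of "(\<Sum>b<m. \<omega> ^ b) * T (Suc (2 * j))" "\<omega> ^ m * T (2 * j)"] \<omega>
      by (simp add: norm_mult norm_power)
    also have "\<dots> \<le> s * (\<nu> ^ j * ?y) + \<nu> ^ j * ?x"
      using Suc s by (intro add_mono mult_left_mono) auto
    also have "\<dots> = \<nu> ^ j * (s * ?y + ?x)" by (simp add: algebra_simps)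
    also have "s * ?y + ?x \<le> \<nu>1 * ?x'"
    proof -
      have "(m - s) * ?x \<le> (m - s) * ?y" using s xy by (intro mult_left_mono) auto
      then have "(s * ?y + ?x) * (m + 1) \<le> (s + 1) * ?x'"
        unfolding x' by (simp add: algebra_simps)
      then show ?thesis by (simp add: \<nu>1_def pos_le_divide_eq)
    qed
    finally have 1: "norm (T (Suc (Suc (2 * j)))) \<le> \<nu> ^ j * (\<nu>1 * ?x')"
      using \<nu>j by (simp add: mult_left_mono)
    have "norm (T (Suc (Suc (Suc (2 * j))))) \<le> norm (T (Suc (Suc (2 * j)))) + norm (T (Suc (2 * j)))"
      unfolding even using norm_triangle_ineq[of "T (Suc (Suc (2 * j)))" "\<omega> * T (Suc (2 * j))"] \<omega>
      by (simp add: norm_mult)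
    also have "\<dots> \<le> \<nu> ^ j * (\<nu>1 * ?x') + \<nu> ^ j * ?y" using 1 Suc by (intro add_mono) auto
    also have "\<dots> = \<nu> ^ j * (\<nu>1 * ?x' + ?y)" by (simp add: algebra_simps)
    also have "\<nu>1 * ?x' + ?y \<le> \<nu> * ?y'"
    proof -
      have "(1 - \<nu>1) * ?y \<le> (1 - \<nu>1) * ?x'" using \<nu>1 xy by (intro mult_left_mono) auto
      then show ?thesis unfolding y' \<nu>_def by (simp add: field_simps)
    qed
    finally have 2: "norm (T (Suc (Suc (Suc (2 * j))))) \<le> \<nu> ^ j * (\<nu> * ?y')"
      using \<nu>j by (simp add: mult_left_mono)
    have "\<nu> ^ j * (\<nu>1 * ?x') \<le> \<nu> ^ j * (\<nu> * ?x')"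
      using \<nu> \<nu>j by (intro mult_left_mono mult_right_mono) auto
    with 1 2 show ?case by (simp add: mult_ac)
  qed
  show thesis by (rule that[of \<nu>]) (use \<nu> main in \<open>auto simp: T_def\<close>)
qed

end

section \<open>Exponential sums\<close>

lemma power_interval_ex:
  fixes x y :: real
  assumes "x > 1" "y \<ge> 1"
  obtains j where "x ^ j \<le> y" "y < x ^ Suc j"
proof -
  define n where "n = (LEAST n. y < x ^ n)"
  have "\<exists>n. y < x ^ n" using real_arch_pow[OF assms(1)] by blast
  then have n: "y < x ^ n" unfolding n_def by (rule LeastI_ex)
  then obtain j where j: "n = Suc j" using assms(2) by (cases n) auto
  have "\<not> y < x ^ j" using not_less_Least[of j "\<lambda>n. y < x ^ n"] j by (simp add: n_def)
  then show ?thesis using n j that[of j] by simp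
qed

text \<open>The exponent is chosen so that \<open>x powr (- \<delta>) = \<mu>\<close>. Taking the
  largest \<open>l\<close> with \<open>x ^ l \<le> N\<close> loses at most one factor \<mu>, which
  goes into the constant.\<close>

lemma power_saving_of_geometric_saving:
  fixes S :: "nat \<Rightarrow> complex" and x \<mu> C :: real
  assumes x: "x > 1" and \<mu>: "0 < \<mu>" "\<mu> < 1" and C: "C \<ge> 0"
    and S: "\<And>l N. x ^ l \<le> real N \<Longrightarrow> norm (S N) \<le> C * N * \<mu> ^ l"
  shows "\<exists>\<delta>>0. \<exists>C'\<ge>0. \<forall>N>0. norm (S N) \<le> C' * real N powr (1 - \<delta>)"
proof -
  let ?\<delta> = "- ln \<mu> / ln x"
  have \<delta>: "?\<delta> > 0" using x \<mu> by (simp add: divide_neg_pos)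
  have C': "C / \<mu> \<ge> 0" using C \<mu> by simp
  have \<mu>_eq: "\<mu> = x powr (- ?\<delta>)" using x \<mu> by (simp add: powr_def)
  have "norm (S N) \<le> C / \<mu> * real N powr (1 - ?\<delta>)" if N: "N > 0" for N
  proof -
    from N obtain l where l: "x ^ l \<le> real N" "real N < x ^ Suc l"
      using power_interval_ex[OF x, of "real N"] by auto
    have "\<mu> * \<mu> ^ l = (x ^ Suc l) powr (- ?\<delta>)"
    proof -
      have "(x ^ Suc l) powr (- ?\<delta>) = (x powr (- ?\<delta>)) ^ Suc l"
        using x by (simp add: powr_power powr_powr mult.commute powr_realpow[symmetric] del: power_Suc)
      then show ?thesis using \<mu>_eq by simp
    qed
    also have "\<dots> \<le> real N powr (- ?\<delta>)"
      using l N \<delta> by (intro powr_mono2') auto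
    finally have le: "\<mu> ^ l \<le> real N powr (- ?\<delta>) / \<mu>" using \<mu> by (simp add: field_simps)
    have "norm (S N) \<le> C * N * \<mu> ^ l" by (rule S[OF l(1)])
    also have "\<dots> \<le> C * N * (real N powr (- ?\<delta>) / \<mu>)"
      using le C by (intro mult_left_mono) auto
    also have "\<dots> = C / \<mu> * (real N powr 1 * real N powr (- ?\<delta>))" using N by simp
    also have "\<dots> = C / \<mu> * real N powr (1 - ?\<delta>)"
      unfolding powr_add[symmetric] by simp
    finally show ?thesis .
  qed
  with \<delta> C' show ?thesis by blast
qed

text \<open>The arithmetic after Cauchy--Schwarz in \<open>mixed_sum_geometric_saving\<close>:
  \<open>a\<close> counts the blocks, \<open>S\<close> is the sum of squares, \<open>L\<close> a
  block length of order \<open>B\<close>, \<open>Y / \<mu>\<close> the Fourier bound,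
  \<open>z\<close> the expected number of block starts per residue class up to a constant, and
  \<open>t\<close> the saving.\<close>

lemma block_level_estimate:
  fixes a S B L M N Y z c \<mu> \<rho> t :: real
  assumes S: "S \<le> c * z * ((Y / \<mu>)\<^sup>2 * L + L ^ 3)" and a: "a * Y \<le> 2 * \<rho> * N" "0 \<le> a"
    and L: "0 \<le> L" "L \<le> 2 * B" and B: "0 \<le> B" "B \<le> Y" and Y: "Y = t * M"
    and z: "z * B = N / M" "0 \<le> z" and nonneg: "0 \<le> c" "0 \<le> N" "0 \<le> t" "0 < M"
  shows "a * S \<le> 2 * \<rho> * (c * (2 / \<mu>\<^sup>2 + 8)) * N\<^sup>2 * t"
proof -
  define y where "y = (Y / \<mu>)\<^sup>2"
  have y: "0 \<le> y" by (simp add: y_def)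
  define d where "d = c * (2 / \<mu>\<^sup>2 + 8)"
  have d: "0 \<le> d" using nonneg by (simp add: d_def)
  have "S \<le> c * z * (y * (2 * B) + (2 * B) ^ 3)"
  proof (rule order_trans[OF S[folded y_def]])
    show "c * z * (y * L + L ^ 3) \<le> c * z * (y * (2 * B) + (2 * B) ^ 3)"
      using L y z(2) nonneg by (intro mult_left_mono add_mono power_mono) auto
  qed
  also have "c * z * (y * (2 * B) + (2 * B) ^ 3) = c * (z * B) * (2 * y + 8 * B\<^sup>2)"
    by (simp add: algebra_simps power2_eq_square power3_eq_cube)
  also have "\<dots> \<le> c * (z * B) * (2 * y + 8 * Y\<^sup>2)"
    using B z(2) nonneg by (intro mult_left_mono add_mono power_mono) auto
  also have "\<dots> = d * (N / M * Y\<^sup>2)"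
    unfolding z(1) d_def y_def by (simp add: power_divide algebra_simps)
  also have "\<dots> = d * N * t * Y"
    using nonneg(4) by (simp add: Y power2_eq_square)
  finally have "a * S \<le> a * (d * N * t * Y)" using a(2) by (rule mult_left_mono)
  also have "\<dots> = a * Y * (d * N * t)" by (simp only: mult_ac)
  also have "\<dots> \<le> 2 * \<rho> * N * (d * N * t)"
    using a(1) d nonneg by (intro mult_right_mono) auto
  also have "\<dots> = 2 * \<rho> * d * N\<^sup>2 * t" by (simp add: power2_eq_square mult_ac)
  finally show ?thesis by (simp add: d_def)
qed

section \<open>Savings in the mixed sum and in the pure Ostrowski sum\<close>

context ostrowski_one_m
begin

text \<open>\<open>H\<close> is the integer part of \<open>B / (12 * m)\<close>, so that
  \<open>2 * m / B\<close> is at most \<open>1 / (6 * H)\<close>. If that integer part is 0, the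
  trivial bound \<open>X\<close> is good enough.\<close>

lemma card_near_zero_progression_scaled:
  fixes M X r :: nat and B :: real
  assumes B: "B \<ge> 1" and M: "M > 0"
  shows "real (card {c. c < X \<and> (\<exists>p::int. \<bar>real (M * c + r) * \<alpha> - p\<bar> \<le> 2 * m / B)})
           \<le> 96 * m * (X / B) + 8 * (m + 3) * (B * M)"
    (is "real (card ?S) \<le> _")
proof (cases "B < 12 * m")
  case True
  have "card ?S \<le> card {..<X}" by (intro card_mono) auto
  then have "real (card ?S) \<le> X" by simp
  also have "\<dots> = B * (X / B)" using B by simp
  also have "\<dots> \<le> 96 * m * (X / B)"
    using True B by (intro mult_right_mono) auto
  also have "\<dots> \<le> 96 * m * (X / B) + 8 * (m + 3) * (B * M)" using B by simp
  finally show ?thesis .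
next
  case False
  define H where "H = nat \<lfloor>B / (12 * m)\<rfloor>"
  have m0: "real m > 0" using m2 by simp
  have ge1: "1 \<le> B / (12 * m)" using False m0 by (simp add: field_simps)
  then have "1 \<le> \<lfloor>B / (12 * m)\<rfloor>" by simp
  then have "real H = of_int \<lfloor>B / (12 * m)\<rfloor>" by (simp add: H_def)
  then have H: "real H \<le> B / (12 * m)" "B / (12 * m) < real H + 1" by linarith+
  then have H1: "H > 0" using ge1 by linarith
  have HB: "real H \<le> B"
  proof -
    have "B / (12 * m) \<le> B / 1" using B m2 by (intro divide_left_mono) auto
    then show ?thesis using H by simp
  qed
  have H2: "B \<le> 24 * m * real H"
  proof -
    have "B / (12 * m) \<le> 2 * real H" using H H1 by linarith
    then show ?thesis using m0 by (simp add: field_simps)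
  qed
  have "2 * m / B \<le> 1 / (6 * real H)" using H m0 H1 B by (simp add: field_simps)
  then have "card ?S \<le> card {c. c < X \<and> (\<exists>p::int. \<bar>real (M * c + r) * \<alpha> - p\<bar> \<le> 1 / (6 * real H))}"
    by (intro card_mono) (auto intro: order_trans)
  then have "real (card ?S) \<le> 4 * (real X / H + 2 * (m + 3) * H * M)"
    using card_near_zero_progression[OF H1 M, of X r] by linarith
  also have "real X / H \<le> 24 * m * (X / B)"
  proof -
    have "X * B \<le> X * (24 * m * real H)" using H2 by (intro mult_left_mono) auto
    then show ?thesis using H1 B by (simp add: field_simps)
  qed
  also have "2 * (m + 3) * H * M \<le> 2 * (m + 3) * (B * M)"
    using HB by (simp add: mult_right_mono mult.assoc mult_left_mono)
  finally show ?thesis by (simp add: algebra_simps)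
qed

lemma mixed_sum_geometric_saving:
  fixes \<zeta> \<omega> :: complex
  assumes q: "q \<ge> 2" and \<zeta>: "norm \<zeta> = 1" "\<zeta> ^ (q - 1) \<noteq> 1" and \<omega>: "norm \<omega> = 1"
  obtains C \<mu> :: real where "C \<ge> 0" "0 < \<mu>" "\<mu> < 1"
    "\<And>l N. (real q ^ 4) ^ l \<le> real N \<Longrightarrow>
       norm (\<Sum>n<N. \<zeta> ^ digit_sum q n * \<omega> ^ osum n) \<le> C * N * \<mu> ^ l"
proof -
  obtain \<mu> :: real where \<mu>: "0 < \<mu>" "\<mu> < 1" "1 \<le> q * \<mu>"
    and sav: "\<And>x y. norm x = 1 \<Longrightarrow> y * \<zeta> ^ (q - 1) = x ^ q \<Longrightarrow>
       norm (\<Sum>d<q. x ^ d) * norm (\<Sum>d<q. y ^ d) \<le> (\<mu> * q)\<^sup>2"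
    by (rule consecutive_factors_saving[OF q \<zeta>]) blast
  define \<rho> where "\<rho> = 1 / (1 - \<alpha>)"
  have \<rho>: "\<rho> > 1" "1 - \<alpha> > 0" using \<alpha>_bounds by (auto simp: \<rho>_def field_simps)
  define c1 where "c1 = 192 * real m + 8 * (m + 3)"
  define c2 where "c2 = 2 * \<rho> * (c1 * (2 / \<mu>\<^sup>2 + 8))"
  have c: "c1 \<ge> 0" "c2 \<ge> 0" using \<rho> by (auto simp: c1_def c2_def)
  have poly: "norm (digit_poly q \<zeta> l z) \<le> (\<mu> * q) ^ l / \<mu>" if "norm z = 1" for l z
  proof (rule norm_digit_poly_bound[OF q \<zeta>(1) \<mu>(1,2)])
    fix x y :: complex
    assume "norm x = 1" "y * \<zeta> ^ (q - 1) = x ^ q"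
    then show "norm (\<Sum>d<q. x ^ d) * norm (\<Sum>d<q. y ^ d) \<le> (\<mu> * q)\<^sup>2" by (rule sav)
  qed (rule that)
  have "\<mu>\<^sup>2 \<le> \<mu>" using \<mu> by (simp add: power2_eq_square mult_left_le_one_le)
  then have \<mu>_sqrt: "\<mu> \<le> sqrt \<mu>" by (rule real_le_rsqrt)
  have main: "norm (\<Sum>n<N. \<zeta> ^ digit_sum q n * \<omega> ^ osum n) \<le> (2 + 2 * sqrt c2) * N * sqrt \<mu> ^ l"
    if N: "(real q ^ 4) ^ l \<le> real N" for l N
  proof -
    define M where "M = q ^ l"
    have M1: "M \<ge> 1" using q by (simp add: M_def)
    define Y where "Y = (\<mu> * q) ^ l"
    have Y1: "Y \<ge> 1" using \<mu> by (simp add: Y_def one_le_power mult.commute)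
    have YM: "Y = \<mu> ^ l * M" by (simp add: Y_def M_def power_mult_distrib)
    have "\<mu> ^ l \<le> 1" using \<mu> by (simp add: power_le_one)
    then have Y_le: "Y \<le> M" unfolding YM using mult_right_mono[of "\<mu> ^ l" 1 "real M"] by simp
    have NM: "real M ^ 4 \<le> N" using N by (simp add: M_def power_mult[symmetric] mult.commute)
    have "real M ^ 1 \<le> real M ^ 4" using M1 by (intro power_increasing) auto
    then have MN: "M \<le> N" using NM by simp
    \<comment> \<open>The level is chosen so that the block length, of order \<open>B\<close>,
      matches the Fourier bound \<open>Y\<close> up to constants; this balances the terms
      \<open>F ^ 2 * L\<close> and \<open>L ^ 3\<close>.\<close>
    obtain j where j: "\<rho> ^ j \<le> Y" "Y < \<rho> ^ Suc j" by (rule power_interval_ex[OF \<rho>(1) Y1])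
    define B where "B = \<rho> ^ j"
    have B1: "B \<ge> 1" using \<rho> by (simp add: B_def one_le_power)
    have \<beta>: "(1 - \<alpha>) ^ j = 1 / B" by (simp add: B_def \<rho>_def power_divide)
    have BY: "B \<le> Y" "Y \<le> \<rho> * B" using j by (simp_all add: B_def)
    have dens: "real (den (Suc (2 * j))) \<le> 2 * B" "B \<le> 2 * real (den (2 * j))"
      using den_odd_bounds[of j] den_odd_le[of j] B1 unfolding \<beta> by (auto simp: field_simps)
    have dens': "real (den (2 * j)) \<le> 2 * B"
      using dens(1) den_mono[of "2 * j"] by linarith
    define k where "k = Suc (2 * j)"
    have k: "k \<ge> 1" "k - 1 = 2 * j" by (simp_all add: k_def)
    define f where "f n = \<zeta> ^ digit_sum q n" for n
    have f1: "norm (f n) \<le> 1" for n using \<zeta> by (simp add: f_def norm_power)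
    obtain A where A: "finite A" "A \<subseteq> block_starts k" "\<And>v. v \<in> A \<Longrightarrow> v < N"
        "card A * den (k - 1) \<le> N"
      and bound: "norm (\<Sum>n<N. f n * \<omega> ^ osum n)
        \<le> den k + (\<Sum>v\<in>A. norm (\<Sum>u<block_len k v. f (v + u) * \<omega> ^ osum u))"
      by (rule block_sum_bound[where F = f and N = N, OF k(1) f1 \<omega>]) blast
    define X where "X = N div M + 1"
    \<comment> \<open>\<open>W\<close> forgets the digits and keeps only that
      \<open>v * \<alpha>\<close> is close to an integer, a condition that can be counted in each
      residue class by a rotation.\<close>
    define W where "W = {n. n < M * X \<and> (\<exists>p::int. \<bar>n * \<alpha> - p\<bar> \<le> 2 * m / B)}"
    have finW: "finite W" by (simp add: W_def)
    have "N < M * X" using M1 by (simp add: X_def dividend_less_times_div)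
    have AW: "A \<subseteq> W"
    proof
      fix v assume v: "v \<in> A"
      have "v < M * X" using A(3)[OF v] \<open>N < M * X\<close> by (rule less_trans)
      moreover have "\<exists>p::int. \<bar>v * \<alpha> - p\<bar> \<le> 2 * m / B"
        using block_starts_near_zero[of v j] A(2) v by (auto simp: k_def \<beta>)
      ultimately show "v \<in> W" by (simp add: W_def)
    qed
    define z where "z = N / (M * B)"
    have zB: "z * B = N / M" using B1 by (simp add: z_def)
    have z0: "z \<ge> 0" using B1 by (simp add: z_def)
    define K where "K = c1 * z"
    have X_le: "real X \<le> 2 * N / M"
    proof -
      have "real (N div M * M) \<le> real N" by (rule of_nat_mono) simp
      then have "real (N div M) \<le> N / M" using M1 by (simp add: pos_le_divide_eq)
      moreover have "1 \<le> real N / M" using MN M1 by simp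
      ultimately show ?thesis by (simp add: X_def)
    qed
    \<comment> \<open>Here \<open>N\<close> must be at least \<open>M ^ 4\<close>: the discrepancy
      term \<open>B * M\<close> of the count is then dominated by the main term
      \<open>z\<close>.\<close>
    have BM: "B * M \<le> z"
    proof -
      have "B * M * (M * B) \<le> real M * M * (M * M)"
        using BY Y_le B1 by (intro mult_mono) auto
      also have "\<dots> = real M ^ 4" by (simp add: power4_eq_xxxx)
      finally have "B * M * (M * B) \<le> N" using NM by linarith
      then show ?thesis using B1 M1 by (simp add: z_def pos_le_divide_eq)
    qed
    have cardW: "real (card {n \<in> W. n mod M = r}) \<le> K" for r
    proof -
      let ?S = "{c. c < X \<and> (\<exists>p::int. \<bar>real (M * c + r) * \<alpha> - p\<bar> \<le> 2 * m / B)}"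
      have "{n \<in> W. n mod M = r} \<subseteq> (\<lambda>c. M * c + r) ` ?S"
      proof
        fix n assume n: "n \<in> {n \<in> W. n mod M = r}"
        then have eq: "n = M * (n div M) + r" by auto
        have "n div M < X" using n M1 by (auto simp: W_def less_mult_imp_div_less mult.commute)
        moreover obtain p :: int where p: "\<bar>n * \<alpha> - p\<bar> \<le> 2 * m / B"
          using n by (auto simp: W_def)
        have "\<bar>real (M * (n div M) + r) * \<alpha> - p\<bar> \<le> 2 * m / B"
          unfolding eq[symmetric] by (rule p)
        ultimately have "n div M \<in> ?S" by blast
        then show "n \<in> (\<lambda>c. M * c + r) ` ?S" using eq by (rule rev_image_eqI)
      qed
      then have "card {n \<in> W. n mod M = r} \<le> card ((\<lambda>c. M * c + r) ` ?S)"
        by (intro card_mono) auto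
      also have "\<dots> \<le> card ?S" by (rule card_image_le) simp
      finally have "card {n \<in> W. n mod M = r} \<le> card ?S" .
      then have "real (card {n \<in> W. n mod M = r}) \<le> 96 * m * (X / B) + 8 * (m + 3) * (B * M)"
        using card_near_zero_progression_scaled[OF B1, of M X r] M1 by linarith
      also have "\<dots> \<le> 96 * m * (2 * N / M / B) + 8 * (m + 3) * z"
        using X_le BM B1 by (intro add_mono mult_left_mono divide_right_mono) auto
      also have "\<dots> = K"
      proof -
        have "2 * N / M / B = 2 * z" by (simp add: z_def)
        then show ?thesis by (simp add: K_def c1_def algebra_simps)
      qed
      finally show ?thesis .
    qed
    \<comment> \<open>Cauchy--Schwarz needs the same inner weights for every \<open>v\<close>, so
      the length \<open>L\<close> is fixed here.\<close>
    have level: "(\<Sum>v\<in>A. norm (\<Sum>u<L. f (v + u) * \<omega> ^ osum u)) \<le> sqrt c2 * N * sqrt \<mu> ^ l"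
      if L: "real L \<le> 2 * B" for L
    proof -
      have "(\<Sum>v\<in>A. (norm (\<Sum>u<L. f (v + u) * \<omega> ^ osum u))\<^sup>2)
          \<le> (\<Sum>v\<in>W. (norm (\<Sum>u<L. f (v + u) * \<omega> ^ osum u))\<^sup>2)"
        using AW finW by (intro sum_mono2) auto
      also have "\<dots> \<le> K * ((Y / \<mu>)\<^sup>2 * L + real L ^ 3)"
        unfolding f_def
      proof (rule shifted_digit_sum_quadratic_bound[where l = l])
        show "norm (digit_poly q \<zeta> l z) \<le> Y / \<mu>" if "norm z = 1" for z
          unfolding Y_def using that by (rule poly)
        show "norm (\<omega> ^ osum u) \<le> 1" for u using \<omega> by (simp add: norm_power)
      qed (use q \<zeta>(1) M_def finW cardW in auto)
      finally have 1: "(\<Sum>v\<in>A. (norm (\<Sum>u<L. f (v + u) * \<omega> ^ osum u))\<^sup>2)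
          \<le> c1 * z * ((Y / \<mu>)\<^sup>2 * L + real L ^ 3)" unfolding K_def .
      have 2: "real (card A) * Y \<le> 2 * \<rho> * N"
      proof -
        have "Y \<le> \<rho> * (2 * real (den (2 * j)))"
          using BY(2) mult_left_mono[OF dens(2), of \<rho>] \<rho> by linarith
        then have "real (card A) * Y \<le> real (card A) * (\<rho> * (2 * real (den (2 * j))))"
          by (rule mult_left_mono) simp
        also have "\<dots> = 2 * \<rho> * real (card A * den (k - 1))" by (simp add: k_def)
        also have "\<dots> \<le> 2 * \<rho> * N"
          using of_nat_mono[OF A(4), where 'a = real] \<rho> by (intro mult_left_mono) auto
        finally show ?thesis .
      qed
      have "(\<Sum>v\<in>A. norm (\<Sum>u<L. f (v + u) * \<omega> ^ osum u))\<^sup>2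
          \<le> (\<Sum>v\<in>A. (norm (\<Sum>u<L. f (v + u) * \<omega> ^ osum u))\<^sup>2) * card A"
        by (rule sum_squared_le_sum_of_squares)
      also have "\<dots> = real (card A) * (\<Sum>v\<in>A. (norm (\<Sum>u<L. f (v + u) * \<omega> ^ osum u))\<^sup>2)"
        by (rule mult.commute)
      also have "\<dots> \<le> c2 * (real N)\<^sup>2 * \<mu> ^ l"
        unfolding c2_def
        by (rule block_level_estimate[OF 1 2 _ _ L _ BY(1) YM zB z0])
           (use c B1 M1 \<mu> in auto)
      also have "\<dots> = (sqrt c2 * N * sqrt \<mu> ^ l)\<^sup>2"
      proof -
        have "(sqrt \<mu> ^ l)\<^sup>2 = ((sqrt \<mu>)\<^sup>2) ^ l" by (simp add: power_mult[symmetric] mult.commute)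
        then show ?thesis using c \<mu> by (simp add: power_mult_distrib)
      qed
      finally show ?thesis
        by (rule power2_le_imp_le) (use c \<mu> in auto)
    qed
    \<comment> \<open>Block lengths take only the two values \<open>den k\<close> and
      \<open>den (k - 1)\<close>; both sums are taken over all of \<open>A\<close>.\<close>
    have "(\<Sum>v\<in>A. norm (\<Sum>u<block_len k v. f (v + u) * \<omega> ^ osum u))
        \<le> (\<Sum>v\<in>A. norm (\<Sum>u<den k. f (v + u) * \<omega> ^ osum u)
             + norm (\<Sum>u<den (k - 1). f (v + u) * \<omega> ^ osum u))"
      by (intro sum_mono) (auto simp: block_len_def simp del: cf_quot.simps)
    also have "\<dots> \<le> sqrt c2 * N * sqrt \<mu> ^ l + sqrt c2 * N * sqrt \<mu> ^ l"
      unfolding sum.distrib using dens(1) dens' by (intro add_mono level) (auto simp: k_def)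
    finally have "norm (\<Sum>n<N. f n * \<omega> ^ osum n) \<le> den k + 2 * (sqrt c2 * N * sqrt \<mu> ^ l)"
      using bound by linarith
    moreover have "real (den k) \<le> 2 * N * sqrt \<mu> ^ l"
    proof -
      have "real (den k) \<le> 2 * (\<mu> ^ l * M)" using dens(1) BY(1) unfolding k_def YM by linarith
      also have "\<dots> \<le> 2 * (sqrt \<mu> ^ l * N)"
        using \<mu> MN \<mu>_sqrt by (intro mult_left_mono mult_mono power_mono) auto
      finally show ?thesis by (simp add: mult_ac)
    qed
    ultimately show ?thesis unfolding f_def by (simp add: algebra_simps)
  qed
  show thesis
    by (rule that[OF _ _ _ main]) (use c \<mu> in auto)
qed

text \<open>Each complete block carries \<open>osum_exp_sum\<close> at \<open>k\<close> or
  \<open>k - 1\<close>, up to a factor of norm 1. The lower bound on \<open>N\<close> makes the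
  boundary term \<open>den k\<close>, of order \<open>1 / (1 - \<alpha>) ^ j\<close>, at most
  \<open>2 * (1 - \<alpha>) ^ j * N\<close>.\<close>

lemma osum_sum_geometric_saving:
  fixes \<omega> :: complex
  assumes \<omega>: "norm \<omega> = 1" "\<omega> \<noteq> 1"
  obtains \<mu> :: real where "0 < \<mu>" "\<mu> < 1"
    "\<And>l N. ((1 / (1 - \<alpha>))\<^sup>2) ^ l \<le> real N \<Longrightarrow> norm (\<Sum>n<N. \<omega> ^ osum n) \<le> 4 * N * \<mu> ^ l"
proof -
  obtain \<nu> :: real where \<nu>: "0 < \<nu>" "\<nu> < 1"
    and T: "\<And>j. norm (osum_exp_sum \<omega> (2 * j)) \<le> \<nu> ^ j * den (2 * j)"
      "\<And>j. norm (osum_exp_sum \<omega> (Suc (2 * j))) \<le> \<nu> ^ j * den (Suc (2 * j))"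
    by (rule osum_exp_sum_saving[OF \<omega>]) (rule that)
  define \<mu> where "\<mu> = max \<nu> (1 - \<alpha>)"
  have \<mu>: "0 < \<mu>" "\<mu> < 1" "\<nu> \<le> \<mu>" "1 - \<alpha> \<le> \<mu>" using \<nu> \<alpha>_bounds by (auto simp: \<mu>_def)
  have main: "norm (\<Sum>n<N. \<omega> ^ osum n) \<le> 4 * N * \<mu> ^ j"
    if N: "((1 / (1 - \<alpha>))\<^sup>2) ^ j \<le> real N" for j N
  proof -
    define k where "k = Suc (2 * j)"
    have k: "k \<ge> 1" "k - 1 = 2 * j" by (simp_all add: k_def)
    obtain A where A: "finite A" "A \<subseteq> block_starts k" "card A * den (k - 1) \<le> N"
      and bound: "norm (\<Sum>n<N. 1 * \<omega> ^ osum n)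
        \<le> den k + (\<Sum>v\<in>A. norm (\<Sum>u<block_len k v. 1 * \<omega> ^ osum u))"
      by (rule block_sum_bound[where F = "\<lambda>_. 1" and N = N, OF k(1) _ \<omega>(1)]) (simp, rule that)
    have "norm (\<Sum>u<block_len k v. \<omega> ^ osum u) \<le> 2 * \<nu> ^ j * den (2 * j)" for v
    proof -
      have "\<nu> ^ j * real (den (Suc (2 * j))) \<le> \<nu> ^ j * real (2 * den (2 * j))"
        using den_odd_le[of j] \<nu> by (intro mult_left_mono of_nat_mono) auto
      moreover have "0 \<le> \<nu> ^ j * real (den (2 * j))" using \<nu> by simp
      ultimately show ?thesis
        using T[of j] by (auto simp: block_len_def k_def osum_exp_sum_def simp del: cf_quot.simps)
    qed
    then have "(\<Sum>v\<in>A. norm (\<Sum>u<block_len k v. \<omega> ^ osum u)) \<le> (\<Sum>v\<in>A. 2 * \<nu> ^ j * den (2 * j))"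
      by (intro sum_mono) auto
    also have "\<dots> = 2 * \<nu> ^ j * real (card A * den (k - 1))" by (simp add: k_def)
    also have "\<dots> \<le> 2 * \<nu> ^ j * N" using A(3) \<nu> by (intro mult_left_mono of_nat_mono) auto
    also have "\<dots> \<le> 2 * \<mu> ^ j * N" using \<mu> \<nu> by (intro mult_right_mono mult_left_mono power_mono) auto
    finally have 1: "(\<Sum>v\<in>A. norm (\<Sum>u<block_len k v. \<omega> ^ osum u)) \<le> 2 * \<mu> ^ j * N" .
    have b: "(1 - \<alpha>) ^ j > 0" using \<alpha>_bounds by simp
    have "1 / ((1 - \<alpha>) ^ j)\<^sup>2 \<le> N"
      using N by (simp add: power_divide power_mult[symmetric] mult.commute)
    then have "2 * (1 / (1 - \<alpha>) ^ j) \<le> 2 * ((1 - \<alpha>) ^ j * N)"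
      using b by (simp add: field_simps power2_eq_square)
    moreover have "real (den k) \<le> 2 * (1 / (1 - \<alpha>) ^ j)"
      using den_odd_bounds(2)[of j] b by (simp add: k_def field_simps)
    moreover have "2 * ((1 - \<alpha>) ^ j * N) \<le> 2 * (\<mu> ^ j * N)"
      using \<mu> \<alpha>_bounds by (intro mult_left_mono mult_right_mono power_mono) auto
    ultimately have "real (den k) \<le> 2 * \<mu> ^ j * N" by simp
    then show ?thesis using 1 bound by (simp add: mult_ac)
  qed
  show thesis by (rule that[OF \<mu>(1,2) main])
qed

text \<open>The case left out is \<zeta> \<noteq> 1 with \<open>\<zeta> ^ (q - 1) = 1\<close>, where
  \<open>\<zeta> ^ digit_sum q n\<close> degenerates to \<open>\<zeta> ^ n\<close>.\<close>

lemma mixed_sum_power_saving: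
  fixes \<zeta> \<omega> :: complex
  assumes q: "q \<ge> 2" and \<zeta>: "norm \<zeta> = 1" and \<omega>: "norm \<omega> = 1"
    and nontrivial: "\<zeta> ^ (q - 1) \<noteq> 1 \<or> \<zeta> = 1 \<and> \<omega> \<noteq> 1"
  shows "\<exists>\<delta>>0. \<exists>C\<ge>0. \<forall>N>0. norm (\<Sum>n<N. \<zeta> ^ digit_sum q n * \<omega> ^ osum n) \<le> C * real N powr (1 - \<delta>)"
  using nontrivial
proof
  assume "\<zeta> ^ (q - 1) \<noteq> 1"
  then obtain C \<mu> :: real where
    "C \<ge> 0" "0 < \<mu>" "\<mu> < 1" "\<And>l N. (real q ^ 4) ^ l \<le> real N \<Longrightarrow>
       norm (\<Sum>n<N. \<zeta> ^ digit_sum q n * \<omega> ^ osum n) \<le> C * N * \<mu> ^ l"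
    by (rule mixed_sum_geometric_saving[OF q \<zeta> _ \<omega>]) (rule that)
  moreover have "real q ^ 4 > 1" using q by simp
  ultimately show ?thesis by (intro power_saving_of_geometric_saving[of "real q ^ 4" \<mu> C]) auto
next
  assume *: "\<zeta> = 1 \<and> \<omega> \<noteq> 1"
  then have "\<omega> \<noteq> 1" by simp
  then obtain \<mu> :: real where
    "0 < \<mu>" "\<mu> < 1" "\<And>l N. ((1 / (1 - \<alpha>))\<^sup>2) ^ l \<le> real N \<Longrightarrow>
       norm (\<Sum>n<N. \<omega> ^ osum n) \<le> 4 * N * \<mu> ^ l"
    by (rule osum_sum_geometric_saving[OF \<omega>]) (rule that)
  moreover have "(1 / (1 - \<alpha>))\<^sup>2 > 1" using \<alpha>_bounds by (intro one_less_power) auto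
  ultimately show ?thesis
    using * by (intro power_saving_of_geometric_saving[of "(1 / (1 - \<alpha>))\<^sup>2" \<mu> 4]) auto
qed

end

section \<open>Counting\<close>

text \<open>Orthogonality detects both congruences. The pair \<open>(0, 0)\<close> yields the main
  term, and the other pairs enter with weights of norm 1; the factor \<open>1 / (M1 * M2)\<close> in
  front of them is given away.\<close>

lemma joint_residue_count_error:
  fixes s t :: "nat \<Rightarrow> nat"
  assumes M: "M1 > 0" "M2 > 0" and r: "r1 < M1" "r2 < M2"
  defines "w1 \<equiv> cis (2 * pi / real M1)" and "w2 \<equiv> cis (2 * pi / real M2)"
  shows "\<bar>real (card {n. n < N \<and> s n mod M1 = r1 \<and> t n mod M2 = r2}) - N / (M1 * M2)\<bar>
    \<le> (\<Sum>(h, k)\<in>{..<M1} \<times> {..<M2} - {(0, 0)}. norm (\<Sum>n<N. (w1 ^ h) ^ s n * (w2 ^ k) ^ t n))"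
proof -
  note w1 = primitive_root_of_unity[OF M(1), folded w1_def]
  note w2 = primitive_root_of_unity[OF M(2), folded w2_def]
  define E where "E = (\<lambda>(h, k). \<Sum>n<N. (w1 ^ h) ^ s n * (w2 ^ k) ^ t n)"
  define c where "c = (\<lambda>(h, k). cnj (w1 ^ (h * r1)) * cnj (w2 ^ (k * r2)))"
  let ?P = "{..<M1} \<times> {..<M2}"
  let ?S = "{n. n < N \<and> s n mod M1 = r1 \<and> t n mod M2 = r2}"
  have c1: "norm (c p) = 1" for p
    using w1(1) w2(1) by (cases p) (simp add: c_def norm_mult norm_power del: complex_cnj_power)
  have o1: "(\<Sum>h<M1. w1 ^ (h * a) * cnj (w1 ^ (h * r1))) = (if a mod M1 = r1 then of_nat M1 else 0)" for a
    using root_of_unity_orthogonality[OF M(1) w1, of a r1] r by simp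
  have o2: "(\<Sum>k<M2. w2 ^ (k * a) * cnj (w2 ^ (k * r2))) = (if a mod M2 = r2 then of_nat M2 else 0)" for a
    using root_of_unity_orthogonality[OF M(2) w2, of a r2] r by simp
  have "of_nat (M1 * M2 * card ?S)
      = (\<Sum>n<N. if s n mod M1 = r1 \<and> t n mod M2 = r2 then of_nat (M1 * M2) else (0 :: complex))"
    by (simp add: sum.If_cases Int_def mult.commute)
  also have "\<dots> = (\<Sum>n<N. (\<Sum>h<M1. w1 ^ (h * s n) * cnj (w1 ^ (h * r1)))
      * (\<Sum>k<M2. w2 ^ (k * t n) * cnj (w2 ^ (k * r2))))"
    unfolding o1 o2 by (intro sum.cong refl) simp
  also have "\<dots> = (\<Sum>n<N. \<Sum>(h, k)\<in>?P. c (h, k) * ((w1 ^ h) ^ s n * (w2 ^ k) ^ t n))"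
    unfolding sum_product sum.cartesian_product c_def
    by (intro sum.cong refl) (simp add: power_mult mult_ac split: prod.splits)
  also have "\<dots> = (\<Sum>p\<in>?P. c p * E p)"
    by (subst sum.swap, rule sum.cong[OF refl]) (auto simp: E_def sum_distrib_left)
  also have "\<dots> = of_nat N + (\<Sum>p\<in>?P - {(0, 0)}. c p * E p)"
    using M by (subst sum.remove[of _ "(0, 0)"]) (auto simp: c_def E_def)
  finally have "norm (of_nat (M1 * M2 * card ?S) - of_nat N :: complex)
      = norm (\<Sum>p\<in>?P - {(0, 0)}. c p * E p)" by simp
  also have "\<dots> \<le> (\<Sum>p\<in>?P - {(0, 0)}. norm (E p))"
    by (rule order_trans[OF norm_sum sum_mono]) (simp add: norm_mult c1)
  also have "of_nat (M1 * M2 * card ?S) - of_nat N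
      = complex_of_real (real (M1 * M2) * (real (card ?S) - N / (M1 * M2)))"
    using M by (simp add: right_diff_distrib)
  finally have le: "real (M1 * M2) * \<bar>real (card ?S) - N / (M1 * M2)\<bar> \<le> (\<Sum>p\<in>?P - {(0, 0)}. norm (E p))"
    unfolding norm_of_real abs_mult by simp
  have "1 * \<bar>real (card ?S) - N / (M1 * M2)\<bar> \<le> real (M1 * M2) * \<bar>real (card ?S) - N / (M1 * M2)\<bar>"
    using M by (intro mult_right_mono) (auto simp: Suc_le_eq simp flip: of_nat_mult)
  with le show ?thesis by (simp add: E_def case_prod_unfold)
qed

lemma residue_iff_mod_eq_nat: "[int x = a] (mod int M) \<longleftrightarrow> x mod M = nat (a mod int M)" if "M > 0"
proof -
  have "[int x = a] (mod int M) \<longleftrightarrow> int (x mod M) = a mod int M"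
    by (simp add: unique_euclidean_semiring_class.cong_def zmod_int)
  then show ?thesis using that by (auto simp: nat_eq_iff2)
qed

theorem corollary1p3:
  fixes q m m1 m2 :: nat and \<alpha> :: real
  assumes "q \<ge> 2" and "m \<ge> 2" and "m1 \<ge> 2" and "m2 \<ge> 2"
    and "\<alpha> = (- real m + sqrt (real m ^ 2 + 4 * real m)) / 2"
    and "gcd (q - 1) m1 = 1" and "gcd m m2 = 1"
  shows "\<exists>\<delta>::real. \<delta> > 0 \<and> ( \<forall>a1 a2 :: int. \<exists>C :: real. \<forall>N :: nat. N > 0 \<longrightarrow>
    \<bar>real (card {n. n < N \<and> [int (digit_sum q n) = a1] (mod int m1)
                       \<and> [ostrowski_sum \<alpha> n = a2] (mod int m2)})
      - real N / (real m1 * real m2)\<bar> \<le> C * real N powr (1 - \<delta>))"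
proof -
  interpret ostrowski_one_m m \<alpha> using assms(2,5) by unfold_locales
  have M: "m1 > 0" "m2 > 0" using assms(3,4) by auto
  define w1 w2 where "w1 = cis (2 * pi / real m1)" and "w2 = cis (2 * pi / real m2)"
  note w1 = primitive_root_of_unity[OF M(1), folded w1_def]
  note w2 = primitive_root_of_unity[OF M(2), folded w2_def]
  define P where "P = {..<m1} \<times> {..<m2} - {(0::nat, 0::nat)}"
  define E where "E = (\<lambda>(h, k) N. \<Sum>n<N. (w1 ^ h) ^ digit_sum q n * (w2 ^ k) ^ osum n)"
  have finP: "finite P" by (simp add: P_def)
  \<comment> \<open>Needed for the minimum over \<open>P\<close> below to be meaningful.\<close>
  have "(1, 0) \<in> P" using assms(3,4) by (simp add: P_def)
  then have Pne: "P \<noteq> {}" by auto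
  have "\<forall>p\<in>P. \<exists>\<delta>>0. \<exists>C\<ge>0. \<forall>N>0. norm (E p N) \<le> C * real N powr (1 - \<delta>)"
  proof
    fix p assume "p \<in> P"
    moreover obtain h k where hk: "p = (h, k)" by (cases p)
    ultimately have p: "h < m1" "k < m2" "h > 0 \<or> k > 0" by (auto simp: P_def)
    \<comment> \<open>Coprimality of \<open>q - 1\<close> and \<open>m1\<close> keeps a nontrivial
      \<open>w1 ^ h\<close> from being a \<open>(q - 1)\<close>-th root of unity.\<close>
    have "(w1 ^ h) ^ (q - 1) \<noteq> 1 \<or> w1 ^ h = 1 \<and> w2 ^ k \<noteq> 1"
    proof (cases "h = 0")
      case True
      then show ?thesis using w2(3)[of k] p by simp
    next
      case False
      have "coprime m1 (q - 1)"
        using assms(6) by (simp add: coprime_iff_gcd_eq_1 gcd.commute)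
      then have "m1 dvd h * (q - 1) \<longleftrightarrow> m1 dvd h" by (rule coprime_dvd_mult_left_iff)
      then have "\<not> m1 dvd h * (q - 1)" using False p(1) by (auto dest: dvd_imp_le)
      then have "0 < (h * (q - 1)) mod m1" by (simp add: mod_greater_zero_iff_not_dvd)
      then have "w1 ^ ((h * (q - 1)) mod m1) \<noteq> 1" using w1(3) M by simp
      then show ?thesis by (simp add: root_of_unity_power_mod[OF w1(2)] power_mult)
    qed
    then show "\<exists>\<delta>>0. \<exists>C\<ge>0. \<forall>N>0. norm (E p N) \<le> C * real N powr (1 - \<delta>)"
      using mixed_sum_power_saving[OF assms(1), of "w1 ^ h" "w2 ^ k"] w1(1) w2(1)
      unfolding hk E_def by (simp add: norm_power)
  qed
  then obtain \<delta> where \<delta>: "\<And>p. p \<in> P \<Longrightarrow> \<delta> p > 0"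
    and "\<forall>p\<in>P. \<exists>C\<ge>0. \<forall>N>0. norm (E p N) \<le> C * real N powr (1 - \<delta> p)"
    by (metis (no_types, lifting))
  then obtain C where C: "\<And>p. p \<in> P \<Longrightarrow> C p \<ge> 0"
    and bound: "\<And>p N. p \<in> P \<Longrightarrow> N > 0 \<Longrightarrow> norm (E p N) \<le> C p * real N powr (1 - \<delta> p)"
    by (metis (no_types, lifting))
  \<comment> \<open>There are finitely many pairs, so the least exponent and the sum of the
    constants serve all of them, independently of the residues \<open>a1\<close> and
    \<open>a2\<close>.\<close>
  define d where "d = Min (\<delta> ` P)"
  have d: "d > 0" "\<And>p. p \<in> P \<Longrightarrow> d \<le> \<delta> p" using finP Pne \<delta> by (auto simp: d_def)
  show ?thesis
  proof (rule exI[of _ d], intro conjI allI exI[of _ "sum C P"] impI)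
    show "d > 0" by (rule d)
    fix a1 a2 :: int and N :: nat
    assume N: "N > 0"
    define r1 r2 where "r1 = nat (a1 mod int m1)" and "r2 = nat (a2 mod int m2)"
    have r: "r1 < m1" "r2 < m2" using M by (auto simp: r1_def r2_def nat_less_iff)
    have "{n. n < N \<and> [int (digit_sum q n) = a1] (mod int m1) \<and> [ostrowski_sum \<alpha> n = a2] (mod int m2)}
        = {n. n < N \<and> digit_sum q n mod m1 = r1 \<and> osum n mod m2 = r2}"
      unfolding int_osum[symmetric] r1_def r2_def using M by (simp only: residue_iff_mod_eq_nat)
    moreover have "\<bar>real (card {n. n < N \<and> digit_sum q n mod m1 = r1 \<and> osum n mod m2 = r2})
        - N / (real m1 * real m2)\<bar> \<le> (\<Sum>p\<in>P. norm (E p N))"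
      using joint_residue_count_error[OF M r, of N "digit_sum q" osum, folded w1_def w2_def]
      by (simp add: E_def P_def case_prod_unfold)
    moreover have "(\<Sum>p\<in>P. norm (E p N)) \<le> (\<Sum>p\<in>P. C p * real N powr (1 - d))"
    proof (intro sum_mono)
      fix p assume p: "p \<in> P"
      have "norm (E p N) \<le> C p * real N powr (1 - \<delta> p)" by (rule bound[OF p N])
      also have "\<dots> \<le> C p * real N powr (1 - d)"
        using N d(2)[OF p] C[OF p] by (intro mult_left_mono powr_mono) auto
      finally show "norm (E p N) \<le> C p * real N powr (1 - d)" .
    qed
    ultimately show "\<bar>real (card {n. n < N \<and> [int (digit_sum q n) = a1] (mod int m1)
                       \<and> [ostrowski_sum \<alpha> n = a2] (mod int m2)})
      - real N / (real m1 * real m2)\<bar> \<le> sum C P * real N powr (1 - d)"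
      by (simp add: sum_distrib_right)
  qed
qed

end
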